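(* Each of the following graph classes has maximum cop number equal to $+\infty$: the class of line graphs; the class of 2-interval graphs; the class of 2-unit-interval graphs; the class of intersection graphs of axis-parallel segments in $\mathbb{R}^3$; the class of intersection graphs of axis-parallel boxes in $\mathbb{R}^3$ (boxicity at most 3); the class of intersection graphs of unit cubes in $\mathbb{R}^3$; the class of intersection graphs of balls in $\mathbb{R}^3$; and the class of intersection graphs of unit balls in $\mathbb{R}^3$.
   Context: Game of cops and robber on a finite graph $G$: first $k$ cops are placed on vertices, then the robber; players then alternate starting with the cops; in a move each cop (resp. the robber) stays or moves to an adjacent vertex. The robber is captured when a cop occupies his vertex. $\textrm{cn}(G)$ is the least $k$ such that $k$ cops can force capture. For a class $\mathcal C$, $\textrm{max-cn}(\mathcal C)$ is the supremum of $\textrm{cn}(G)$ over connected $G\in\mathcal C$. A line graph is the intersection graph of the edges of some graph (two edges adjacent iff they share an endpoint). A 2-interval graph is an intersection graph of sets each of which is a union of 2 closed intervals of $\mathbb{R}$; a 2-unit-interval graph is such a graph where all these intervals have length one. Intersection graph of a family of sets: vertices are the sets, two distinct vertices adjacent iff their sets intersect. *)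

theory Defs
  imports "HOL-Analysis.Analysis"
begin

text \<open>Finite simple graphs: a vertex set and a symmetric irreflexive adjacency
relation supported on the vertex set. Vertices are natural numbers (every finite
graph is isomorphic to such a graph; all classes below are isomorphism-closed).\<close>

type_synonym graph = "nat set \<times> (nat \<Rightarrow> nat \<Rightarrow> bool)"

definition verts :: "graph \<Rightarrow> nat set" where "verts G = fst G"
definition adj :: "graph \<Rightarrow> nat \<Rightarrow> nat \<Rightarrow> bool" where "adj G = snd G"

definition wf_graph :: "graph \<Rightarrow> bool" where
  "wf_graph G \<longleftrightarrow> finite (verts G)
     \<and> (\<forall>u v. adj G u v \<longrightarrow> u \<in> verts G \<and> v \<in> verts G)
     \<and> (\<forall>u v. adj G u v \<longrightarrow> adj G v u)
     \<and> (\<forall>u. \<not> adj G u u)"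

definition connected_graph :: "graph \<Rightarrow> bool" where
  "connected_graph G \<longleftrightarrow> verts G \<noteq> {}
     \<and> (\<forall>u\<in>verts G. \<forall>v\<in>verts G. (adj G)\<^sup>*\<^sup>* u v)"

definition step :: "graph \<Rightarrow> nat \<Rightarrow> nat \<Rightarrow> bool" where
  "step G x y \<longleftrightarrow> x = y \<or> adj G x y"

text \<open>cw G C r: the cops at positions C (a list, one entry per cop) are to move,
the robber is at r and not yet captured, and the cops can force capture in finitely
many rounds (least fixed point = attractor of the finite reachability game).\<close>
inductive cw :: "graph \<Rightarrow> nat list \<Rightarrow> nat \<Rightarrow> bool" for G where
  "\<lbrakk> list_all2 (step G) C C';
     r \<in> set C' \<or> (\<forall>r'. step G r r' \<longrightarrow> r' \<in> set C' \<or> cw G C' r') \<rbrakk>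
   \<Longrightarrow> cw G C r"

definition cops_win :: "graph \<Rightarrow> nat \<Rightarrow> bool" where
  "cops_win G k \<longleftrightarrow> (\<exists>C. length C = k \<and> set C \<subseteq> verts G
      \<and> (\<forall>r\<in>verts G. r \<in> set C \<or> cw G C r))"

definition cop_number :: "graph \<Rightarrow> nat" where
  "cop_number G = (LEAST k. cops_win G k)"

definition max_cn :: "graph set \<Rightarrow> enat" where
  "max_cn \<C> = (SUP G \<in> {G \<in> \<C>. connected_graph G}. enat (cop_number G))"

definition is_intersection_graph :: "'b set set \<Rightarrow> graph \<Rightarrow> bool" where
  "is_intersection_graph S G \<longleftrightarrow> (\<exists>f. inj_on f (verts G) \<and> f ` verts G \<subseteq> S
     \<and> (\<forall>u\<in>verts G. \<forall>v\<in>verts G. adj G u v \<longleftrightarrow> u \<noteq> v \<and> f u \<inter> f v \<noteq> {}))"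

definition intersection_class :: "'b set set \<Rightarrow> graph set" where
  "intersection_class S = {G. wf_graph G \<and> is_intersection_graph S G}"

text \<open>Line graphs: intersection graphs of the edge set of some simple graph H
(edges = 2-element vertex sets, two edges adjacent iff they share an endpoint).\<close>
definition is_line_graph :: "graph \<Rightarrow> bool" where
  "is_line_graph G \<longleftrightarrow> (\<exists>F :: nat set set. finite F \<and> (\<forall>e\<in>F. card e = 2)
     \<and> (\<exists>f. bij_betw f (verts G) F
       \<and> (\<forall>u\<in>verts G. \<forall>v\<in>verts G. adj G u v \<longleftrightarrow> u \<noteq> v \<and> f u \<inter> f v \<noteq> {})))"

definition line_graphs :: "graph set" where
  "line_graphs = {G. wf_graph G \<and> is_line_graph G}"

definition two_intervals :: "real set set" where
  "two_intervals = {{a..b} \<union> {c..d} | a b c d. a \<le> b \<and> c \<le> d}"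

definition two_unit_intervals :: "real set set" where
  "two_unit_intervals = {{a..a+1} \<union> {c..c+1} | a c. True}"

definition axis_segments3 :: "(real^3) set set" where
  "axis_segments3 = {closed_segment p q | p q. p \<noteq> q \<and> (\<exists>i. \<forall>j. j \<noteq> i \<longrightarrow> p$j = q$j)}"

definition axis_boxes3 :: "(real^3) set set" where
  "axis_boxes3 = {cbox a b | a b. \<forall>i. a$i \<le> b$i}"

definition unit_cubes3 :: "(real^3) set set" where
  "unit_cubes3 = {cbox a b | a b. \<forall>i. b$i = a$i + 1}"

definition balls3 :: "(real^3) set set" where
  "balls3 = {cball c r | c r. r > 0}"

definition unit_balls3 :: "(real^3) set set" where
  "unit_balls3 = {cball c 1 | c. True}"

end

theory Submission
  imports Defs
begin

text \<open>All classes are handled by one robber strategy. Start from the point-line incidence graph of an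
  affine plane, which has girth larger than four and large minimum degree. Replace every vertex by a
  gadget of diameter at most \<open>h\<close> and every edge by a path of length \<open>L > 2 * h\<close> between two gadgets.
  The robber waits at the port of some gadget \<open>v\<close> through which he arrived, keeping every cop either
  behind him on the path he came along or at distance more than \<open>h\<close> from the gadget. Because of the
  girth, a cop can reach the gadgets of at most two further neighbours of \<open>v\<close> early enough to
  matter, so with few cops some neighbour is free, and the robber runs there and restores the
  invariant.

  Clique gadgets give line graphs, which are 2-unit-interval graphs: use the unit interval at \<open>3 * a\<close>
  for the vertex \<open>a\<close>. One-vertex gadgets give graphs that can be drawn with axis-parallel segments.
  Path gadgets give graphs of maximum degree three that are induced subgraphs of the integer grid in
  space, which is itself a contact graph of unit balls and of unit cubes.\<close>

section \<open>Escape strategies and inclusions between the classes\<close>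

text \<open>Vertices of a \<open>graph\<close> are natural numbers, so graphs over structured types
  are transported along \<open>to_nat\<close>.\<close>

definition coded_graph :: "'a::countable set \<Rightarrow> ('a \<Rightarrow> 'a \<Rightarrow> bool) \<Rightarrow> graph" where
  "coded_graph N R = (to_nat ` N, \<lambda>u v. \<exists>a\<in>N. \<exists>b\<in>N. u = to_nat a \<and> v = to_nat b \<and> R a b)"

lemma verts_coded_graph [simp]: "verts (coded_graph N R) = to_nat ` N"
  by (simp add: coded_graph_def verts_def)

lemma adj_coded_graph:
  "adj (coded_graph N R) u v \<longleftrightarrow> (\<exists>a\<in>N. \<exists>b\<in>N. u = to_nat a \<and> v = to_nat b \<and> R a b)"
  by (simp add: coded_graph_def adj_def)

lemma adj_coded_graph_to_nat [simp]:
  "adj (coded_graph N R) (to_nat a) (to_nat b) \<longleftrightarrow> a \<in> N \<and> b \<in> N \<and> R a b"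
  by (auto simp: adj_coded_graph)

lemma wf_coded_graph:
  assumes "finite N" "symp R" "irreflp R"
  shows "wf_graph (coded_graph N R)"
  using assms by (auto simp: wf_graph_def adj_coded_graph dest: sympD irreflpD)

lemma connected_coded_graph:
  assumes "N \<noteq> {}" "\<And>a b. a \<in> N \<Longrightarrow> b \<in> N \<Longrightarrow> (\<lambda>a b. a \<in> N \<and> b \<in> N \<and> R a b)\<^sup>*\<^sup>* a b"
  shows "connected_graph (coded_graph N R)"
proof -
  have "(adj (coded_graph N R))\<^sup>*\<^sup>* (to_nat a) (to_nat b)"
    if "(\<lambda>a b. a \<in> N \<and> b \<in> N \<and> R a b)\<^sup>*\<^sup>* a b" for a b
    using that
    by induction (auto intro: rtranclp.rtrancl_into_rtrancl)
  with assms show ?thesis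
    by (auto simp: connected_graph_def)
qed

lemma intersection_class_coded_graph:
  assumes "finite N" "symp R" "irreflp R" "f ` N \<subseteq> S" "inj_on f N"
    and "\<And>a b. a \<in> N \<Longrightarrow> b \<in> N \<Longrightarrow> a \<noteq> b \<Longrightarrow> R a b \<longleftrightarrow> f a \<inter> f b \<noteq> {}"
  shows "coded_graph N R \<in> intersection_class S"
proof -
  have "is_intersection_graph S (coded_graph N R)"
    unfolding is_intersection_graph_def
  proof (intro exI[of _ "f \<circ> from_nat"] conjI ballI)
    show "inj_on (f \<circ> from_nat) (verts (coded_graph N R))"
      using assms(5) by (auto simp: inj_on_def)
    show "(f \<circ> from_nat) ` verts (coded_graph N R) \<subseteq> S"
      using assms(4) by auto
    show "adj (coded_graph N R) u v \<longleftrightarrow>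
        u \<noteq> v \<and> (f \<circ> from_nat) u \<inter> (f \<circ> from_nat) v \<noteq> {}"
      if uv: "u \<in> verts (coded_graph N R)" "v \<in> verts (coded_graph N R)" for u v
    proof -
      obtain a b where "a \<in> N" "u = to_nat a" "b \<in> N" "v = to_nat b"
        using uv unfolding verts_coded_graph by blast
      then show ?thesis
        using assms(6)[of a b] irreflpD[OF assms(3), of a] by (cases "a = b") auto
    qed
  qed
  with assms(1-3) show ?thesis
    by (simp add: intersection_class_def wf_coded_graph)
qed

text \<open>\<open>cw\<close> is a least fixed point: by induction on a winning derivation, an
  invariant that the robber can restore after every cop move excludes such a derivation.\<close>

lemma cw_robber_escapes:
  assumes "cw G C r"
    and "\<And>C r C'. Safe C r \<Longrightarrow> list_all2 (step G) C C' \<Longrightarrow>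
      r \<notin> set C' \<and> (\<exists>r'. step G r r' \<and> r' \<notin> set C' \<and> Safe C' r')"
  shows "\<not> Safe C r"
  using assms(1)
proof induction
  case (1 C C' r)
  then show ?case
    using assms(2)[of C r C'] by blast
qed

text \<open>Here \<open>Q m a\<close> is the condition on a cop at \<open>a\<close> when the robber is in state \<open>m\<close> and the cops
  are to move, and \<open>Q' m a\<close> the one when the robber is to move.\<close>
lemma not_cops_win_coded_graph:
  fixes N :: "'a::countable set" and pos :: "'m \<Rightarrow> 'a"
  assumes pos: "\<And>m. valid m \<Longrightarrow> pos m \<in> N"
    and cop_move: "\<And>m a b. valid m \<Longrightarrow> Q m a \<Longrightarrow> a \<in> N \<Longrightarrow> b \<in> N \<Longrightarrow> a = b \<or> R a b \<Longrightarrow> Q' m b"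
    and robber_move: "\<And>m D. valid m \<Longrightarrow> D \<subseteq> N \<Longrightarrow> finite D \<Longrightarrow> card D \<le> k \<Longrightarrow> (\<And>c. c \<in> D \<Longrightarrow> Q' m c)
      \<Longrightarrow> \<exists>m'. valid m' \<and> R (pos m) (pos m') \<and> (\<forall>c\<in>D. Q m' c)"
    and not_captured: "\<And>m. valid m \<Longrightarrow> \<not> Q' m (pos m)"
    and start: "\<And>D. D \<subseteq> N \<Longrightarrow> finite D \<Longrightarrow> card D \<le> k \<Longrightarrow> \<exists>m. valid m \<and> (\<forall>c\<in>D. Q m c)"
    and "j \<le> k"
  shows "\<not> cops_win (coded_graph N R) j"
proof
  let ?G = "coded_graph N R"
  \<comment> \<open>The list of cops is read as a set of at most \<open>k\<close> nodes; the state
    \<open>m\<close> may record more than the robber's position.\<close>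
  define Safe where "Safe = (\<lambda>C r. length C \<le> k \<and> set C \<subseteq> to_nat ` N \<and>
    (\<exists>m. valid m \<and> r = to_nat (pos m) \<and> (\<forall>c\<in>N. to_nat c \<in> set C \<longrightarrow> Q m c)))"
  \<comment> \<open>Staying put is a cop move, so \<open>Q m\<close> at the robber's own position
    would give \<open>Q' m\<close> there.\<close>
  have not_Q: "\<not> Q m (pos m)" if "valid m" for m
    using cop_move not_captured pos that by blast
  have card_cops: "finite {c\<in>N. to_nat c \<in> set C} \<and> card {c\<in>N. to_nat c \<in> set C} \<le> k"
    if "length C \<le> k" for C
  proof -
    have "{c\<in>N. to_nat c \<in> set C} \<subseteq> from_nat ` set C"
      by force
    moreover have "card (from_nat ` set C :: 'a set) \<le> card (set C)"
      by (rule card_image_le) simp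
    then have "card (from_nat ` set C :: 'a set) \<le> k"
      using card_length[of C] that by simp
    ultimately show ?thesis
      by (meson List.finite_set card_mono finite_imageI finite_subset le_trans)
  qed
  assume "cops_win ?G j"
  then obtain C where C: "length C = j" "set C \<subseteq> to_nat ` N"
    and win: "\<And>r. r \<in> to_nat ` N \<Longrightarrow> r \<in> set C \<or> cw ?G C r"
    by (auto simp: cops_win_def)
  obtain m where m: "valid m" "\<forall>c\<in>{c\<in>N. to_nat c \<in> set C}. Q m c"
    using start[of "{c\<in>N. to_nat c \<in> set C}"] card_cops[of C] C(1) \<open>j \<le> k\<close> by auto
  have safe: "Safe C (to_nat (pos m))"
    using C m \<open>j \<le> k\<close> by (auto simp: Safe_def)
  have "to_nat (pos m) \<notin> set C"
    using m not_Q pos by blast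
  with win pos[OF m(1)] have "cw ?G C (to_nat (pos m))"
    by blast
  moreover have "r \<notin> set C' \<and> (\<exists>r'. step ?G r r' \<and> r' \<notin> set C' \<and> Safe C' r')"
    if "Safe C r" and mv: "list_all2 (step ?G) C C'" for C r C'
  proof -
    from \<open>Safe C r\<close> obtain m where len: "length C \<le> k" and CN: "set C \<subseteq> to_nat ` N"
      and m: "valid m" "r = to_nat (pos m)" "\<And>c. c \<in> N \<Longrightarrow> to_nat c \<in> set C \<Longrightarrow> Q m c"
      by (auto simp: Safe_def)
    have len': "length C' \<le> k"
      using len mv list_all2_lengthD by force
    have from_C: "\<exists>a\<in>N. to_nat a \<in> set C \<and> (\<exists>b\<in>N. x = to_nat b \<and> (a = b \<or> R a b))"
      if "x \<in> set C'" for x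
    proof -
      obtain y where "y \<in> set C" "step ?G y x"
        using mv \<open>x \<in> set C'\<close> by (metis in_set_conv_nth list_all2_conv_all_nth)
      with CN show ?thesis
        by (force simp: step_def adj_coded_graph)
    qed
    have CN': "set C' \<subseteq> to_nat ` N"
      using from_C by blast
    have Q': "Q' m c" if "c \<in> N" "to_nat c \<in> set C'" for c
      using from_C[OF that(2)] m cop_move that by (metis to_nat_split)
    have "r \<notin> set C'"
      using Q' m not_captured pos by blast
    moreover obtain m' where m': "valid m'" "R (pos m) (pos m')"
      "\<And>c. c \<in> N \<Longrightarrow> to_nat c \<in> set C' \<Longrightarrow> Q m' c"
      using robber_move[OF m(1), of "{c\<in>N. to_nat c \<in> set C'}"] card_cops[OF len'] Q' by auto
    moreover have "to_nat (pos m') \<notin> set C'"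
      using m' not_Q pos by blast
    moreover have "Safe C' (to_nat (pos m'))"
      using len' CN' m' by (auto simp: Safe_def)
    moreover have "step ?G r (to_nat (pos m'))"
      using m m' pos by (auto simp: step_def)
    ultimately show ?thesis
      by blast
  qed
  ultimately have "\<not> Safe C (to_nat (pos m))"
    by (rule cw_robber_escapes)
  with safe show False
    by contradiction
qed

section \<open>Cop numbers, their supremum, and inclusions between the classes\<close>

text \<open>One cop on every vertex captures at once; this guarantees that the \<open>LEAST\<close>
  in \<open>cop_number\<close> is attained.\<close>

lemma cops_win_card_verts:
  assumes "finite (verts G)"
  shows "cops_win G (card (verts G))"
  unfolding cops_win_def
  using assms by (intro exI[of _ "sorted_list_of_set (verts G)"]) simp

lemma cop_number_gt:
  assumes "finite (verts G)" "\<And>j. j \<le> k \<Longrightarrow> \<not> cops_win G j"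
  shows "k < cop_number G"
  using LeastI[of "cops_win G", OF cops_win_card_verts[OF assms(1)]] assms(2)
  unfolding cop_number_def by (meson not_le_imp_less)

lemma max_cn_eq_infinity:
  assumes "\<And>k. \<exists>G\<in>\<C>. connected_graph G \<and> k < cop_number G"
  shows "max_cn \<C> = \<infinity>"
proof (rule ccontr)
  assume "max_cn \<C> \<noteq> \<infinity>"
  then obtain k where k: "max_cn \<C> = enat k"
    by auto
  obtain G where G: "G \<in> \<C>" "connected_graph G" "k < cop_number G"
    using assms by blast
  then have "enat (cop_number G) \<le> max_cn \<C>"
    unfolding max_cn_def by (intro SUP_upper) simp
  with G k show False
    by simp
qed

lemma max_cn_mono: "\<C> \<subseteq> \<D> \<Longrightarrow> max_cn \<C> \<le> max_cn \<D>"
  unfolding max_cn_def by (intro SUP_subset_mono) auto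

lemma intersection_class_mono: "S \<subseteq> T \<Longrightarrow> intersection_class S \<subseteq> intersection_class T"
  by (auto simp: intersection_class_def is_intersection_graph_def)

lemma line_graphs_subset_two_unit_intervals: "line_graphs \<subseteq> intersection_class two_unit_intervals"
proof
  fix G assume "G \<in> line_graphs"
  then have wf: "wf_graph G" and "is_line_graph G"
    by (simp_all add: line_graphs_def)
  then obtain F :: "nat set set" and f where F: "\<forall>e\<in>F. card e = 2" and f: "bij_betw f (verts G) F"
    and adj: "\<forall>u\<in>verts G. \<forall>v\<in>verts G. adj G u v \<longleftrightarrow> u \<noteq> v \<and> f u \<inter> f v \<noteq> {}"
    unfolding is_line_graph_def by (elim exE conjE)
  define I :: "nat set \<Rightarrow> real set" where "I e = (\<Union>n\<in>e. {3 * real n..3 * real n + 1})" for e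
  have same: "n = m"
    if "x \<in> {3 * real n..3 * real n + 1}" "x \<in> {3 * real m..3 * real m + 1}" for n m x
    using that unfolding atLeastAtMost_iff by linarith
  \<comment> \<open>The left endpoint \<open>3 * real n\<close> detects membership of
    \<open>n\<close>, because intervals of different numbers are disjoint; hence \<open>I\<close> is
    injective and reflects intersections.\<close>
  have memI: "3 * real n \<in> I e \<longleftrightarrow> n \<in> e" for n e
  proof
    have self: "3 * real n \<in> {3 * real n..3 * real n + 1}"
      by simp
    show "n \<in> e" if "3 * real n \<in> I e"
      using that same[OF self] unfolding I_def by blast
    show "3 * real n \<in> I e" if "n \<in> e"
      using that self unfolding I_def by blast
  qed
  have "inj I"
    by (rule injI) (metis memI set_eqI)
  have I_meet: "I e \<inter> I e' \<noteq> {} \<longleftrightarrow> e \<inter> e' \<noteq> {}" for e e'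
  proof
    assume "I e \<inter> I e' \<noteq> {}"
    then obtain x n m where "n \<in> e" "m \<in> e'"
      "x \<in> {3 * real n..3 * real n + 1}" "x \<in> {3 * real m..3 * real m + 1}"
      unfolding I_def by blast
    with same show "e \<inter> e' \<noteq> {}"
      by blast
  next
    assume "e \<inter> e' \<noteq> {}"
    with memI show "I e \<inter> I e' \<noteq> {}"
      by blast
  qed
  have "I e \<in> two_unit_intervals" if "e \<in> F" for e
  proof -
    obtain a b where "e = {a, b}"
      using F \<open>e \<in> F\<close> by (auto simp: card_2_iff)
    then show ?thesis
      unfolding two_unit_intervals_def I_def by auto
  qed
  then have "(I \<circ> f) ` verts G \<subseteq> two_unit_intervals"
    using f by (auto simp: bij_betw_def)
  moreover have "inj_on (I \<circ> f) (verts G)"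
    using f \<open>inj I\<close> by (intro comp_inj_on) (auto simp: bij_betw_def intro: inj_on_subset)
  ultimately have "is_intersection_graph two_unit_intervals G"
    unfolding is_intersection_graph_def using adj
    by (intro exI[of _ "I \<circ> f"]) (simp add: I_meet)
  with wf show "G \<in> intersection_class two_unit_intervals"
    by (simp add: intersection_class_def)
qed

lemma two_unit_intervals_subset: "two_unit_intervals \<subseteq> two_intervals"
  unfolding two_unit_intervals_def two_intervals_def by force

lemma unit_balls3_subset: "unit_balls3 \<subseteq> balls3"
  unfolding unit_balls3_def balls3_def by force

lemma closed_segment_eq_cbox_cart:
  fixes p q :: "real^'n"
  assumes le: "p$i \<le> q$i" and pq: "\<And>j. j \<noteq> i \<Longrightarrow> p$j = q$j"
  shows "closed_segment p q = cbox p q"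
proof (cases "p = q")
  case False
  then have lt: "p$i < q$i"
    using le pq by (metis order_le_less vec_eq_iff)
  show ?thesis
  proof
    show "closed_segment p q \<subseteq> cbox p q"
      using le pq by (intro closed_segment_subset) (auto simp: mem_box_cart convex_box, (metis order_refl)+)
    show "cbox p q \<subseteq> closed_segment p q"
    proof
      fix x assume x: "x \<in> cbox p q"
      \<comment> \<open>The affine parameter read off from the only coordinate that varies.\<close>
      define t where "t = (x$i - p$i) / (q$i - p$i)"
      have "x$j = ((1 - t) *\<^sub>R p + t *\<^sub>R q)$j" for j
      proof (cases "j = i")
        case True
        have "t * (q$i - p$i) = x$i - p$i"
          using lt by (simp add: t_def)
        then show ?thesis
          using True by (simp add: algebra_simps)
      next
        case False
        then show ?thesis
          using x pq[of j] by (auto simp: mem_box_cart algebra_simps intro: order_antisym dest: spec[of _ j])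
      qed
      moreover have "0 \<le> t" "t \<le> 1"
        using x lt by (auto simp: t_def mem_box_cart divide_simps dest: spec[of _ i])
      ultimately show "x \<in> closed_segment p q"
        by (auto simp: in_segment vec_eq_iff)
    qed
  qed
qed simp

lemma axis_segments3_subset: "axis_segments3 \<subseteq> axis_boxes3"
proof
  fix s assume "s \<in> axis_segments3"
  then obtain p q :: "real^3" and i where s: "s = closed_segment p q" and pq: "\<And>j. j \<noteq> i \<Longrightarrow> p$j = q$j"
    unfolding axis_segments3_def by blast
  have "s = cbox p q \<and> (\<forall>j. p$j \<le> q$j) \<or> s = cbox q p \<and> (\<forall>j. q$j \<le> p$j)"
  proof (cases "p$i \<le> q$i")
    case True
    then have "\<forall>j. p$j \<le> q$j"
      using pq by (metis order_refl)
    with True closed_segment_eq_cbox_cart[of p i q] pq s show ?thesis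
      by blast
  next
    case False
    then have "\<forall>j. q$j \<le> p$j" "q$i \<le> p$i"
      using pq by (metis order_refl linear)+
    with closed_segment_eq_cbox_cart[of q i p] pq s show ?thesis
      by (simp add: closed_segment_commute)
  qed
  then show "s \<in> axis_boxes3"
    unfolding axis_boxes3_def by blast
qed

section \<open>A base graph of large minimum degree and girth\<close>

text \<open>The degree bound exceeds by one the number of neighbours excluded in
  \<open>unthreatened_neighbour\<close>.\<close>

locale base_graph =
  fixes V :: "nat set" and E :: "nat \<Rightarrow> nat \<Rightarrow> bool" and k :: nat
  assumes finite_V: "finite V" and V_nonempty: "V \<noteq> {}"
    and E_V: "E x y \<Longrightarrow> x \<in> V"
    and E_sym: "E x y \<Longrightarrow> E y x"
    and E_irrefl: "\<not> E x x"
    and E_no_triangle: "E x y \<Longrightarrow> E y z \<Longrightarrow> \<not> E x z"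
    and E_no_4_cycle: "E x u \<Longrightarrow> E y u \<Longrightarrow> E x u' \<Longrightarrow> E y u' \<Longrightarrow> x \<noteq> y \<Longrightarrow> u = u'"
    and degree: "x \<in> V \<Longrightarrow> 2 * k + 2 \<le> card {u. E x u}"
    and connected: "x \<in> V \<Longrightarrow> y \<in> V \<Longrightarrow> E\<^sup>*\<^sup>* x y"
begin

lemma E_V2: "E x y \<Longrightarrow> y \<in> V"
  using E_V E_sym by blast

end

section \<open>The incidence graph of an affine plane over a prime field\<close>

locale point_line_incidence =
  fixes p :: nat
  assumes prime: "prime p"
begin

text \<open>Incidence of the point \<open>(a, b)\<close> with the line \<open>y = m x - c\<close> of the affine plane over the
  prime field; in this form the relation is symmetric in \<open>(a, b)\<close> and \<open>(m, c)\<close>.\<close>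
fun inc :: "bool \<times> int \<times> int \<Rightarrow> bool \<times> int \<times> int \<Rightarrow> bool" where
  "inc (s, a, b) (t, m, c) \<longleftrightarrow> s \<noteq> t \<and> {a, b, m, c} \<subseteq> {0..<int p} \<and> int p dvd a * m - b - c"

text \<open>The vertices of the incidence graph: points and lines, told apart by the Boolean; not
  incident pairs, despite the name.\<close>

definition flags :: "(bool \<times> int \<times> int) set" where
  "flags = UNIV \<times> {0..<int p} \<times> {0..<int p}"

lemma p_pos: "0 < int p"
  using prime prime_gt_0_nat by simp

lemma dvd_diff_small:
  assumes "int p dvd x - y" "x \<in> {0..<int p}" "y \<in> {0..<int p}"
  shows "x = y"
  using assms by (metis atLeastLessThan_iff mod_eq_dvd_iff mod_pos_pos_trivial)

lemma inc_sym: "inc x y \<Longrightarrow> inc y x"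
  by (cases x; cases y) (auto simp: algebra_simps)

lemma inc_flags: "inc x y \<Longrightarrow> x \<in> flags"
  by (cases x; cases y) (auto simp: flags_def)

lemma inc_no_triangle: "inc x y \<Longrightarrow> inc y z \<Longrightarrow> \<not> inc x z"
  by (cases x; cases y; cases z) auto

text \<open>The alternating sum of the four incidences factors as
  \<open>(a - a') * (m - m')\<close>. By primality two first coordinates agree, and incidence then
  forces the second ones to agree as well.\<close>

lemma inc_no_4_cycle:
  assumes "inc x u" "inc y u" "inc x u'" "inc y u'" "x \<noteq> y"
  shows "u = u'"
proof -
  obtain s a b where x: "x = (s, a, b)" by (cases x)
  obtain s' a' b' where y: "y = (s', a', b')" by (cases y)
  obtain t m c where u: "u = (t, m, c)" by (cases u)
  obtain t' m' c' where u': "u' = (t', m', c')" by (cases u')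
  have st: "s' = s" "t = (\<not> s)" "t' = (\<not> s)" and range: "{a, b, m, c, a', b', m', c'} \<subseteq> {0..<int p}"
    using assms unfolding x y u u' by auto
  have d: "int p dvd a * m - b - c" "int p dvd a' * m - b' - c"
    "int p dvd a * m' - b - c'" "int p dvd a' * m' - b' - c'"
    using assms unfolding x y u u' by auto
  have "int p dvd (a * m - b - c) - (a' * m - b' - c) - ((a * m' - b - c') - (a' * m' - b' - c'))"
    by (rule dvd_diff[OF dvd_diff[OF d(1,2)] dvd_diff[OF d(3,4)]])
  then have "int p dvd (a - a') * (m - m')"
    by (simp add: algebra_simps)
  then consider "int p dvd a - a'" | "int p dvd m - m'"
    using prime by (meson prime_dvd_mult_iff prime_nat_int_transfer)
  then show ?thesis
  proof cases
    case 1
    then have a: "a = a'"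
      using range dvd_diff_small by simp
    have "int p dvd (a' * m - b' - c) - (a * m - b - c)"
      by (rule dvd_diff[OF d(2,1)])
    then have "b = b'"
      using range dvd_diff_small by (simp add: a)
    with a st \<open>x \<noteq> y\<close> show ?thesis
      by (simp add: x y)
  next
    case 2
    then have m: "m = m'"
      using range dvd_diff_small by simp
    have "int p dvd (a * m' - b - c') - (a * m - b - c)"
      by (rule dvd_diff[OF d(3,1)])
    then have "c = c'"
      using range dvd_diff_small by (simp add: m)
    with m st show ?thesis
      by (simp add: u u')
  qed
qed

text \<open>The incidence congruence is solved for its last coordinate: one neighbour for each slope
  \<open>m\<close>.\<close>

lemma inc_meet:
  assumes "a \<in> {0..<int p}" "b \<in> {0..<int p}" "m \<in> {0..<int p}"
  shows "inc (s, a, b) (\<not> s, m, (a * m - b) mod int p)"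
  using assms p_pos by (auto simp: mod_eq_dvd_iff[symmetric] mod_diff_right_eq simp flip: minus_mod_eq_mult_div)

lemma finite_flags: "finite flags"
  by (simp add: flags_def)

lemma inc_degree:
  assumes "x \<in> flags"
  shows "p \<le> card {u. inc x u}"
proof -
  obtain s a b where x: "x = (s, a, b)" by (cases x)
  define g where "g m = (\<not> s, m, (a * m - b) mod int p)" for m
  have "g ` {0..<int p} \<subseteq> {u. inc x u}"
    using assms inc_meet by (auto simp: x g_def flags_def simp del: inc.simps)
  moreover have "finite {u. inc x u}"
    using finite_flags by (rule finite_subset[rotated]) (auto intro: inc_flags inc_sym)
  ultimately have "card (g ` {0..<int p}) \<le> card {u. inc x u}"
    by (rule card_mono[rotated])
  moreover have "inj_on g {0..<int p}"
    by (auto simp: inj_on_def g_def)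
  ultimately show ?thesis
    by (simp add: card_image)
qed

text \<open>Two steps: onto the line of slope \<open>m\<close> through the point, then back to the
  point of that line over \<open>a'\<close>.\<close>

lemma inc_shift:
  assumes "a \<in> {0..<int p}" "b \<in> {0..<int p}" "a' \<in> {0..<int p}" "m \<in> {0..<int p}"
  shows "inc\<^sup>*\<^sup>* (s, a, b) (s, a', (b + (a' - a) * m) mod int p)"
proof -
  let ?l = "(\<not> s, m, (a * m - b) mod int p)"
  have "inc ?l (s, a', (m * a' - (a * m - b) mod int p) mod int p)"
    using inc_meet[of m "(a * m - b) mod int p" a' "\<not> s"] assms p_pos by simp
  moreover have "(m * a' - (a * m - b) mod int p) mod int p = (b + (a' - a) * m) mod int p"
    by (simp add: mod_diff_right_eq algebra_simps)
  ultimately have "inc ?l (s, a', (b + (a' - a) * m) mod int p)"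
    by metis
  with inc_meet[OF assms(1,2,4), of s] show ?thesis
    by (meson converse_rtranclp_into_rtranclp r_into_rtranclp)
qed

lemma inc_raise:
  assumes "a \<in> {0..<int p}" "b \<in> {0..<int p}"
  shows "inc\<^sup>*\<^sup>* (s, a, b) (s, 0, (b + int n) mod int p)"
proof (induction n)
  case 0
  show ?case
    using inc_shift[OF assms, of 0 0 s] p_pos by simp
next
  case (Suc n)
  have p: "1 < int p"
    using prime prime_gt_1_nat by simp
  let ?b = "(b + int n) mod int p"
  have "inc\<^sup>*\<^sup>* (s, 0, ?b) (s, 1, (?b + (1 - 0) * 0) mod int p)"
    by (rule inc_shift) (use p in auto)
  \<comment> \<open>The slope \<open>int p - 1\<close> is -1 modulo \<open>p\<close>, so going back
    from abscissa 1 to 0 raises the ordinate by one.\<close>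
  moreover have "inc\<^sup>*\<^sup>* (s, 1, ?b) (s, 0, (?b + (0 - 1) * (int p - 1)) mod int p)"
    by (rule inc_shift) (use p in auto)
  moreover have "(?b + (0 - 1) * (int p - 1)) mod int p = (b + int (Suc n)) mod int p"
  proof -
    have "(?b + (0 - 1) * (int p - 1)) mod int p = (?b + 1 - int p) mod int p"
      by (simp add: algebra_simps)
    also have "\<dots> = (?b + 1) mod int p"
      by (metis minus_mod_self2)
    finally show ?thesis
      by (simp add: mod_add_right_eq algebra_simps)
  qed
  ultimately show ?case
    using Suc by simp
qed

lemma inc_to_origin:
  assumes "x \<in> flags"
  shows "inc\<^sup>*\<^sup>* x (True, 0, 0)"
proof -
  \<comment> \<open>Raising by \<open>int p - b\<close> wraps the ordinate around to 0.\<close>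
  have point: "inc\<^sup>*\<^sup>* (s, a, b) (s, 0, 0)" if "a \<in> {0..<int p}" "b \<in> {0..<int p}" for s a b
    using inc_raise[OF that, of s "nat (int p - b)"] that by simp
  obtain s a b where x: "x = (s, a, b)" by (cases x)
  have "inc (s, 0, 0) (\<not> s, 0, 0)"
    using p_pos by simp
  with point[of a b s] assms show ?thesis
    by (cases s) (auto simp: x flags_def simp del: inc.simps)
qed

lemma inc_connected:
  assumes "x \<in> flags" "y \<in> flags"
  shows "inc\<^sup>*\<^sup>* x y"
proof -
  have "symp inc"
    using inc_sym by (rule sympI)
  then have "inc\<^sup>*\<^sup>* (True, 0, 0) y"
    using inc_to_origin[OF assms(2)] by (metis symp_rtranclp sympD)
  with inc_to_origin[OF assms(1)] show ?thesis
    by (rule rtranclp_trans)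
qed

lemma base_graph_incidence:
  assumes "2 * k + 2 \<le> p"
  shows "base_graph (to_nat ` flags) (\<lambda>u v. \<exists>x y. u = to_nat x \<and> v = to_nat y \<and> inc x y) k"
proof
  let ?E = "\<lambda>u v. \<exists>x y. u = to_nat x \<and> v = to_nat y \<and> inc x y"
  show "finite (to_nat ` flags)"
    by (simp add: finite_flags)
  show "to_nat ` flags \<noteq> {}"
    using p_pos by (auto simp: flags_def)
  show "u \<in> to_nat ` flags" if "?E u v" for u v
    using that inc_flags by blast
  show "?E v u" if "?E u v" for u v
    using that inc_sym by blast
  show "\<not> ?E u u" for u
    by auto
  show "\<not> ?E u w" if "?E u v" "?E v w" for u v w
    using that inc_no_triangle by (auto simp del: inc.simps)
  show "u = u'" if "?E x u" "?E y u" "?E x u'" "?E y u'" "x \<noteq> y" for x y u u'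
    using that inc_no_4_cycle by (auto simp del: inc.simps)
  show "2 * k + 2 \<le> card {v. ?E u v}" if u: "u \<in> to_nat ` flags" for u
  proof -
    obtain x where x: "x \<in> flags" "u = to_nat x"
      using u by blast
    have "{v. ?E u v} = to_nat ` {y. inc x y}"
      using x by auto
    then show ?thesis
      using inc_degree[OF x(1)] assms by (simp add: card_image)
  qed
  have "?E\<^sup>*\<^sup>* (to_nat x) (to_nat y)" if "inc\<^sup>*\<^sup>* x y" for x y
    using that by induction (auto simp del: inc.simps intro: rtranclp.rtrancl_into_rtrancl)
  then show "?E\<^sup>*\<^sup>* u v" if "u \<in> to_nat ` flags" "v \<in> to_nat ` flags" for u v
    using that inc_connected by blast
qed

end

lemma base_graph_exists: "\<exists>V E. base_graph V E k"
proof -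
  obtain p :: nat where "prime p" "2 * k + 2 < p"
    using bigger_prime by blast
  then interpret point_line_incidence p
    by unfold_locales
  show ?thesis
    using base_graph_incidence[of k] \<open>2 * k + 2 < p\<close> by auto
qed

section \<open>Replacing vertices by gadgets\<close>

text \<open>\<open>Half x y i\<close> is the \<open>i\<close>-th inner vertex, counted from \<open>x\<close>, of the path that replaces the
  edge \<open>xy\<close>; the path is cut in the middle, so that its other half consists of the \<open>Half y x i\<close>.\<close>
datatype node = Gad nat nat | Half nat nat nat

instance node :: countable
  by countable_datatype

lemma card_UN_le_mult:
  assumes "finite I" "\<And>i. i \<in> I \<Longrightarrow> card (f i) \<le> n"
  shows "card (\<Union>i\<in>I. f i) \<le> card I * n"
  using card_UN_le[OF assms(1), of f] sum_bounded_above[of I "\<lambda>i. card (f i)" n] assms(2) by simp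

lemma card_insert_le_Suc: "card (insert x S) \<le> Suc (card S)"
  by (cases "finite S") (auto simp: card_insert_if)

text \<open>\<open>gd\<close> is the graph metric of the gadget: adjacency is distance 1, and
  \<open>gd_Suc\<close> gives the first step of a shortest path. \<open>port x y\<close> is where
  the path towards \<open>y\<close> leaves the gadget of \<open>x\<close>, and \<open>K\<close> is
  the number of inner vertices on half a path.\<close>

locale gadget_graph = base_graph +
  fixes A :: "nat set" and gd :: "nat \<Rightarrow> nat \<Rightarrow> nat" and port :: "nat \<Rightarrow> nat \<Rightarrow> nat" and h K :: nat
  assumes finite_A: "finite A"
    and port_A: "E x y \<Longrightarrow> port x y \<in> A"
    and gd_0: "gd a b = 0 \<longleftrightarrow> a = b"
    and gd_sym: "gd a b = gd b a"
    and gd_triangle: "a \<in> A \<Longrightarrow> b \<in> A \<Longrightarrow> c \<in> A \<Longrightarrow> gd a c \<le> gd a b + gd b c"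
    and gd_le: "a \<in> A \<Longrightarrow> b \<in> A \<Longrightarrow> gd a b \<le> h"
    and gd_Suc: "a \<in> A \<Longrightarrow> c \<in> A \<Longrightarrow> gd a c = Suc n \<Longrightarrow> \<exists>b\<in>A. gd a b = 1 \<and> gd b c = n"
    and h_le_K: "h \<le> K" and K_pos: "0 < K"
begin

text \<open>The halves of a path are linked at their \<open>K\<close>-th vertices;
  \<open>x \<noteq> y\<close> there makes \<open>R\<close> irreflexive on all nodes, also outside
  \<open>N\<close>.\<close>

fun R :: "node \<Rightarrow> node \<Rightarrow> bool" where
  "R (Gad x a) (Gad y b) \<longleftrightarrow> x = y \<and> gd a b = 1"
| "R (Gad x a) (Half y z i) \<longleftrightarrow> x = y \<and> a = port y z \<and> i = 1"
| "R (Half y z i) (Gad x a) \<longleftrightarrow> x = y \<and> a = port y z \<and> i = 1"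
| "R (Half x y i) (Half x' y' j) \<longleftrightarrow>
    x = x' \<and> y = y' \<and> (i = Suc j \<or> j = Suc i) \<or> x = y' \<and> y = x' \<and> x \<noteq> y \<and> i = K \<and> j = K"

definition N :: "node set" where
  "N = {Gad x a | x a. x \<in> V \<and> a \<in> A} \<union> {Half x y i | x y i. E x y \<and> 1 \<le> i \<and> i \<le> K}"

lemma Gad_N [simp]: "Gad x a \<in> N \<longleftrightarrow> x \<in> V \<and> a \<in> A"
  by (auto simp: N_def)

lemma Half_N [simp]: "Half x y i \<in> N \<longleftrightarrow> E x y \<and> 1 \<le> i \<and> i \<le> K"
  by (auto simp: N_def)

lemma symp_R: "symp R"
proof (rule sympI)
  show "R t s" if "R s t" for s t
    using that by (cases s; cases t) (auto simp: gd_sym)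
qed

lemma irreflp_R: "irreflp R"
proof (rule irreflpI)
  have "gd a a = 0" for a
    using gd_0 by blast
  then show "\<not> R s s" for s
    by (cases s) auto
qed

abbreviation H :: graph where
  "H \<equiv> coded_graph N R"

lemma finite_N: "finite N"
proof (rule finite_subset)
  show "N \<subseteq> (\<lambda>(x, a). Gad x a) ` (V \<times> A) \<union> (\<lambda>(x, y, i). Half x y i) ` (V \<times> V \<times> {..K})"
  proof
    fix s assume "s \<in> N"
    then show "s \<in> (\<lambda>(x, a). Gad x a) ` (V \<times> A) \<union> (\<lambda>(x, y, i). Half x y i) ` (V \<times> V \<times> {..K})"
      by (cases s) (auto simp: image_iff E_V E_V2)
  qed
  show "finite ((\<lambda>(x, a). Gad x a) ` (V \<times> A) \<union> (\<lambda>(x, y, i). Half x y i) ` (V \<times> V \<times> {..K}))"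
    using finite_V finite_A by simp
qed

text \<open>\<open>K\<close> links on each half, the one at the port included, and the link in the
  middle.\<close>

definition L :: nat where "L = 2 * K + 1"

text \<open>For an edge \<open>vu\<close> along which the robber runs from the gadget of \<open>v\<close> to that of \<open>u\<close>, consider
  the graph in which the last link of the corresponding path is removed, so that the path is a dead
  end attached to the gadget of \<open>v\<close>. There, \<open>far v u\<close> is a lower bound for the distance to the
  gadget of \<open>u\<close>, and \<open>rest v u\<close> is one for the distance to the port at \<open>u\<close> through the removed link.
  All distances are capped at \<open>2 * L\<close>.\<close>

definition far0 :: "nat \<Rightarrow> nat \<Rightarrow> nat \<Rightarrow> nat" where
  "far0 v u x = (if x = u then 0 else if E x u \<and> x \<noteq> v then L else 2 * L)"

fun far :: "nat \<Rightarrow> nat \<Rightarrow> node \<Rightarrow> nat" where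
  "far v u (Gad x a) = far0 v u x"
| "far v u (Half x y i) = (if {x, y} = {v, u} then 2 * L
     else min (2 * L) (min (far0 v u x + i) (far0 v u y + (L - i))))"

fun rest :: "nat \<Rightarrow> nat \<Rightarrow> node \<Rightarrow> nat" where
  "rest v u (Gad x a) = (if x = v then L + gd a (port v u) else 2 * L)"
| "rest v u (Half x y i) =
    (if x = v \<and> y = u then L - i
     else if x = u \<and> y = v then i
     else if x = v then min (2 * L) (L + gd (port v y) (port v u) + i)
     else if y = v then min (2 * L) (L + gd (port v x) (port v u) + (L - i))
     else 2 * L)"

section \<open>Unit speed of the cops and the safety condition\<close>

lemma far0_lipschitz:
  assumes "E x y" "{x, y} \<noteq> {v, u}"
  shows "far0 v u x \<le> far0 v u y + L"
  \<comment> \<open>The values are 0, \<open>L\<close> and \<open>2 * L\<close>, and an edge at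
    \<open>u\<close> other than \<open>vu\<close> has value \<open>L\<close> at its other
    end.\<close>
  using assms E_sym[OF assms(1)] by (auto simp: far0_def)

text \<open>The last two hypotheses keep the cop off the removed link in both directions:
  \<open>rest\<close> is 1 at its end on the path, and \<open>far\<close> is 0 on the gadget of
  \<open>u\<close>.\<close>

lemma far_lipschitz:
  assumes "E v u" "s \<in> N" "t \<in> N" "R s t" "rest v u s \<ge> 2" "far v u s \<ge> 1"
  shows "far v u s \<le> far v u t + 1"
proof (cases s; cases t)
  fix x a y b assume s: "s = Gad x a" and t: "t = Gad y b"
  with assms show ?thesis by simp
next
  fix x a y z i assume s: "s = Gad x a" and t: "t = Half y z i"
  with assms have "x = y" "i = 1" "E y z" by auto
  moreover have "x \<noteq> u"
    using assms(6) by (auto simp: s far0_def)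
  ultimately show ?thesis
    using far0_lipschitz[of y z v u] by (auto simp: s t far0_def L_def min_def)
next
  fix x a y z i assume s: "s = Half y z i" and t: "t = Gad x a"
  with assms have eq: "x = y" "i = 1" "E y z" by auto
  moreover have "far0 v u v = 2 * L"
    using assms(1) E_irrefl by (auto simp: far0_def)
  moreover have "v \<noteq> u"
    using assms(1) E_irrefl by blast
  ultimately show ?thesis
    using assms(5) by (auto simp: s t doubleton_eq_iff)
next
  fix x y i x' y' j assume s: "s = Half x y i" and t: "t = Half x' y' j"
  show ?thesis
  proof (cases "x = x' \<and> y = y'")
    case True
    then have ij: "i = Suc j \<or> j = Suc i" "i \<le> K" "j \<le> K"
      using assms(2-4) E_irrefl by (auto simp: s t)
    show ?thesis
    proof (cases "{x, y} = {v, u}")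
      case True
      with \<open>x = x' \<and> y = y'\<close> show ?thesis
        by (simp add: s t)
    next
      case False
      with \<open>x = x' \<and> y = y'\<close> show ?thesis
        unfolding s t far.simps L_def using ij by (simp only: if_False) linarith
    qed
  next
    case False
    then have "x = y'" "y = x'" "i = K" "j = K"
      using assms(2-4) by (auto simp: s t)
    then show ?thesis
      by (auto simp: s t min_def L_def insert_commute)
  qed
qed

lemma min_le_Suc: "a \<le> Suc b \<Longrightarrow> min c a \<le> Suc (min c b)"
  by (simp add: min_def)

lemma rest_lipschitz:
  assumes "E v u" "s \<in> N" "t \<in> N" "R s t" "rest v u s \<ge> 2" "far v u s \<ge> 1"
  shows "rest v u s \<le> rest v u t + 1"
proof -
  note [[linarith_neq_limit = 0]]
  have "v \<noteq> u"
    using assms(1) E_irrefl by blast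
  show ?thesis
  proof (cases s; cases t)
    fix x a y b assume s: "s = Gad x a" and t: "t = Gad y b"
    with assms have "x = y" "gd a b = 1" "a \<in> A" "b \<in> A" by auto
    then show ?thesis
      using gd_triangle[of a b "port v u"] port_A[OF assms(1)] by (simp add: s t)
  next
    fix x a y z i assume s: "s = Gad x a" and t: "t = Half y z i"
    with assms have "x = y" "i = 1" "E y z" "a = port y z" by auto
    moreover have "x \<noteq> u"
      using assms(6) by (auto simp: s far0_def)
    moreover have "gd (port v u) (port v u) = 0"
      using gd_0 by blast
    \<comment> \<open>Gadget distances stay below \<open>L\<close>, so the cap \<open>2 * L\<close>
      costs at most what the step allows.\<close>
    moreover have "gd (port y z) (port y u) \<le> L" if "y = v"
      using gd_le[of "port y z" "port y u"] port_A \<open>E y z\<close> assms(1) h_le_K that by (force simp: L_def)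
    ultimately show ?thesis
      using E_irrefl by (auto simp: s t L_def min_def)
  next
    fix x a y z i assume s: "s = Half y z i" and t: "t = Gad x a"
    then have *: "x = y" "i = 1" "a = port y z" "y \<noteq> z"
      using assms(2,4) E_irrefl by auto
    moreover have "y \<noteq> u \<or> z \<noteq> v"
      using assms(5) * \<open>v \<noteq> u\<close> by (auto simp: s)
    ultimately show ?thesis
      using \<open>v \<noteq> u\<close> by (cases "y = v"; cases "z = u"; cases "z = v") (simp_all add: s t)
  next
    fix x y i x' y' j assume s: "s = Half x y i" and t: "t = Half x' y' j"
    have "x \<noteq> y"
      using assms(2) E_irrefl by (auto simp: s)
    show ?thesis
    proof (cases "x = x' \<and> y = y'")
      case True
      then have ij: "i \<le> Suc j" "L - i \<le> Suc (L - j)"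
        using assms(2-4) E_irrefl by (auto simp: s t)
      then show ?thesis
        using True \<open>v \<noteq> u\<close> \<open>x \<noteq> y\<close>
        by (cases "x = v"; cases "y = u"; cases "y = v"; cases "x = u") (simp_all add: s t min_le_Suc)
    next
      case False
      then have *: "x' = y" "y' = x" "i = K" "j = K"
        using assms(2-4) by (auto simp: s t)
      moreover have "K \<le> Suc (L - K)" "L - K \<le> Suc K"
        by (auto simp: L_def)
      ultimately show ?thesis
        using \<open>x \<noteq> y\<close> \<open>v \<noteq> u\<close>
        by (cases "x = v"; cases "y = u"; cases "y = v"; cases "x = u") (simp_all add: s t min_le_Suc)
    qed
  qed
qed

text \<open>\<open>n\<close> counts the moves the robber still needs to reach
  \<open>port u v\<close>. A cop following him stays strictly behind, and any other cop is still
  more than \<open>h\<close> away from the gadget of \<open>u\<close> when he arrives.\<close>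

definition safe :: "nat \<Rightarrow> nat \<Rightarrow> nat \<Rightarrow> node \<Rightarrow> bool" where
  "safe v u n c \<longleftrightarrow> rest v u c \<ge> n + 1 \<and> far v u c \<ge> h + 1 + n"

lemma safe_cop_move:
  assumes "E v u" "s \<in> N" "t \<in> N" "s = t \<or> R s t" "safe v u (Suc n) s"
  shows "safe v u n t"
proof (cases "s = t")
  case False
  with assms have "R s t" by blast
  from far_lipschitz[OF assms(1-3) this] rest_lipschitz[OF assms(1-3) this] assms(5)
  show ?thesis
    by (simp add: safe_def)
qed (use assms in \<open>simp add: safe_def\<close>)

text \<open>The route crosses the gadget of \<open>v\<close> to \<open>port v u\<close> and then
  follows the path; \<open>n\<close> is the number of steps left.\<close>

fun on_route :: "nat \<Rightarrow> nat \<Rightarrow> nat \<Rightarrow> node \<Rightarrow> bool" where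
  "on_route v u n (Gad x a) \<longleftrightarrow> a \<in> A \<and> (n = 0 \<and> x = u \<and> a = port u v \<or> x = v \<and> n = L + gd a (port v u))"
| "on_route v u n (Half x y i) \<longleftrightarrow>
    1 \<le> i \<and> i \<le> K \<and> (x = v \<and> y = u \<and> n = L - i \<or> x = u \<and> y = v \<and> n = i)"

lemma on_route_N:
  assumes "E v u" "on_route v u n r"
  shows "r \<in> N"
  using assms E_V[OF assms(1)] E_V2[OF assms(1)] E_sym[OF assms(1)] by (cases r) auto

lemma on_route_not_safe:
  assumes "E v u" "on_route v u n r"
  shows "\<not> safe v u n r"
proof (cases r)
  case (Gad x a)
  with assms(2) show ?thesis
    by (auto simp: safe_def far0_def)
next
  case (Half x y i)
  have "u \<noteq> v"
    using assms(1) E_irrefl by blast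
  with assms(2) have "rest v u r = n"
    by (auto simp: Half)
  then show ?thesis
    by (simp add: safe_def)
qed

lemma on_route_step:
  assumes "E v u" "on_route v u (Suc n) r"
  shows "\<exists>r'. on_route v u n r' \<and> R r r'"
proof (cases r)
  case (Gad x a)
  with assms have x: "x = v" "a \<in> A" "n = 2 * K + gd a (port v u)"
    by (auto simp: L_def)
  show ?thesis
  proof (cases "gd a (port v u)")
    case 0
    with gd_0 have "a = port v u"
      by blast
    with 0 x K_pos show ?thesis
      by (intro exI[of _ "Half v u 1"]) (auto simp: Gad L_def)
  next
    case (Suc m)
    then obtain b where "b \<in> A" "gd a b = 1" "gd b (port v u) = m"
      using gd_Suc port_A x assms(1) by blast
    with x Suc show ?thesis
      by (intro exI[of _ "Gad v b"]) (auto simp: Gad L_def)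
  qed
next
  case (Half x y i)
  \<comment> \<open>The robber is on the half at \<open>v\<close>, before the middle link, before
    the link into the gadget of \<open>u\<close>, or further back on the half at
    \<open>u\<close>.\<close>
  then consider "x = v" "y = u" "i < K" "1 \<le> i" "Suc n = L - i" | "x = v" "y = u" "i = K" "n = K"
    | "x = u" "y = v" "i = 1" "n = 0" | "x = u" "y = v" "1 < i" "i \<le> K" "n = i - 1"
    using assms by (auto simp: L_def) linarith+
  then show ?thesis
  proof cases
    case 1
    then show ?thesis
      by (intro exI[of _ "Half v u (Suc i)"]) (auto simp: Half L_def)
  next
    case 2
    then show ?thesis
      using K_pos assms(1) E_irrefl by (intro exI[of _ "Half u v K"]) (auto simp: Half)
  next
    case 3
    then show ?thesis
      using port_A E_sym assms(1) by (intro exI[of _ "Gad u (port u v)"]) (auto simp: Half)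
  next
    case 4
    then show ?thesis
      by (intro exI[of _ "Half u v n"]) (auto simp: Half)
  qed
qed

section \<open>Choosing the next neighbour to run to\<close>

fun ends :: "node \<Rightarrow> nat set" where
  "ends (Gad x a) = {x}"
| "ends (Half x y i) = {x, y}"

lemma card_ends: "finite (ends c) \<and> card (ends c) \<le> 2"
  by (cases c) (auto simp: card_insert_if)

text \<open>Neighbours of \<open>v\<close> that a cop near \<open>x\<close> might reach too early,
  being there or one path away. For \<open>x = v\<close> the set is empty: cops near
  \<open>v\<close> are controlled by \<open>rest\<close>.\<close>

definition threatened :: "nat \<Rightarrow> nat \<Rightarrow> nat set" where
  "threatened v x = {u. E v u \<and> (u = x \<or> E u x \<and> x \<noteq> v)}"

text \<open>A second threatened neighbour would close a triangle, or a 4-cycle through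
  \<open>v\<close> and \<open>x\<close>.\<close>

lemma threatened_eq: "u \<in> threatened v x \<Longrightarrow> u' \<in> threatened v x \<Longrightarrow> u = u'"
  using E_no_triangle E_no_4_cycle[of v u x u'] E_sym unfolding threatened_def by blast

lemma card_threatened: "finite (threatened v x) \<and> card (threatened v x) \<le> 1"
proof (cases "threatened v x = {}")
  case False
  then obtain u where "threatened v x = {u}"
    using threatened_eq by blast
  then show ?thesis
    by simp
qed simp

text \<open>The robber has arrived at \<open>v\<close> from \<open>w\<close> and turns to
  \<open>u\<close>. As no end of the cop threatens \<open>u\<close>, \<open>far\<close> takes its
  maximal value \<open>2 * L\<close>, which suffices because \<open>L\<close> exceeds
  \<open>2 * h\<close>; the work lies in \<open>rest\<close>.\<close>

lemma safe_unthreatened: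
  assumes "E w v" "E v u" "w \<noteq> u" "c \<in> N" "h + 1 \<le> far w v c"
    and "\<And>x. x \<in> ends c \<Longrightarrow> u \<notin> threatened v x"
  shows "safe v u (L + gd (port v w) (port v u)) c"
proof -
  let ?g = "gd (port v w) (port v u)"
  have g: "?g \<le> h"
    using gd_le port_A E_sym assms(1,2) by blast
  have far0: "far0 v u x = 2 * L" if "x \<in> ends c" for x
    using assms(6)[OF that] assms(2) E_sym by (auto simp: threatened_def far0_def)
  have "far v u c = 2 * L"
    using far0 by (cases c) auto
  moreover have "L + ?g + 1 \<le> rest v u c"
  proof (cases c)
    case (Gad x a)
    then have "x \<noteq> v"
      using assms(5) by (auto simp: far0_def)
    with g h_le_K show ?thesis
      by (simp add: Gad L_def)
  next
    case (Half x y i)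
    then have i: "E x y" "1 \<le> i" "i \<le> K"
      using assms(4) by auto
    have ne: "v \<noteq> w" "x \<noteq> y" "u \<noteq> v"
      using assms(1,2) i E_irrefl by blast+
    have u: "u \<notin> {x, y}"
      using assms(6)[of u] assms(2) by (auto simp: Half threatened_def)
    \<comment> \<open>\<open>d\<close> is the cop's distance to the gadget of \<open>v\<close> on
      the path to \<open>z\<close>. On the arrival path he must pass the robber's port and is at
      least one step behind; elsewhere \<open>h + 1\<close> exceeds the robber's way
      \<open>?g\<close> through the gadget.\<close>
    have near: "L + ?g + 1 \<le> min (2 * L) (L + gd (port v z) (port v u) + d)"
      if "z = w \<or> h + 1 \<le> d" "1 \<le> d" for z d
      using that(1)
    proof
      assume "z = w"
      then show ?thesis
        using g h_le_K \<open>1 \<le> d\<close> by (simp add: L_def)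
    next
      assume "h + 1 \<le> d"
      then show ?thesis
        using g h_le_K by (simp add: L_def)
    qed
    consider "x = v" | "x \<noteq> v" "y = v" | "x \<noteq> v" "y \<noteq> v"
      by blast
    then show ?thesis
    proof cases
      case 1
      have "y = w \<or> h + 1 \<le> i"
        using 1 assms(5) ne(1) by (cases "y = w") (auto simp: Half far0_def doubleton_eq_iff)
      from near[OF this i(2)] 1 u ne(3) show ?thesis
        by (simp add: Half)
    next
      case 2
      have "x = w \<or> h + 1 \<le> L - i"
        using 2 assms(5) ne(1) by (cases "x = w") (auto simp: Half far0_def doubleton_eq_iff)
      moreover have "1 \<le> L - i"
        using i(3) by (simp add: L_def)
      ultimately have "L + ?g + 1 \<le> min (2 * L) (L + gd (port v x) (port v u) + (L - i))"
        by (rule near)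
      with 2 u ne(3) show ?thesis
        by (simp add: Half)
    next
      case 3
      then have "rest v u c = 2 * L"
        by (simp add: Half)
      then show ?thesis
        using g h_le_K by (simp add: L_def)
    qed
  qed
  ultimately show ?thesis
    using g h_le_K by (simp add: safe_def L_def)
qed

text \<open>A cop has at most two ends, each threatening at most one neighbour of \<open>v\<close>;
  together with \<open>w\<close> this excludes at most \<open>2 * k + 1\<close>.\<close>

lemma unthreatened_neighbour:
  assumes "v \<in> V" "finite D" "card D \<le> k"
  shows "\<exists>u. E v u \<and> u \<noteq> w \<and> (\<forall>c\<in>D. \<forall>x\<in>ends c. u \<notin> threatened v x)"
proof -
  let ?T = "\<Union>c\<in>D. \<Union>x\<in>ends c. threatened v x"
  have "card (\<Union>x\<in>ends c. threatened v x) \<le> 2" for c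
    using card_UN_le_mult[of "ends c" "threatened v" 1] card_ends[of c] card_threatened by fastforce
  then have "card ?T \<le> 2 * k"
    using card_UN_le_mult[OF assms(2), of "\<lambda>c. \<Union>x\<in>ends c. threatened v x" 2] assms(3) by simp
  then have "card (insert w ?T) \<le> 2 * k + 1"
    using card_insert_le_Suc[of w ?T] by linarith
  moreover have "finite (insert w ?T)"
    using assms(2) card_ends card_threatened by blast
  ultimately have "\<not> {u. E v u} \<subseteq> insert w ?T"
    using degree[OF assms(1)] card_mono[of "insert w ?T" "{u. E v u}"] by linarith
  then show ?thesis
    by blast
qed

lemma start_vertex:
  assumes "finite D" "card D \<le> k"
  shows "\<exists>v\<in>V. \<forall>c\<in>D. v \<notin> ends c"
proof -
  obtain x where "x \<in> V"
    using V_nonempty by blast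
  then have "2 * k + 2 \<le> card V"
    using degree[of x] card_mono[OF finite_V, of "{u. E x u}"] E_V2 by fastforce
  moreover have "card (\<Union>c\<in>D. ends c) \<le> 2 * k"
    using card_UN_le_mult[OF assms(1), of ends 2] card_ends assms(2) by simp
  ultimately have "\<not> V \<subseteq> (\<Union>c\<in>D. ends c)"
    using card_mono[of "\<Union>c\<in>D. ends c" V] assms(1) card_ends by fastforce
  then show ?thesis
    by blast
qed

text \<open>At the start the robber poses as having just arrived at \<open>v\<close> from an
  arbitrary neighbour \<open>w\<close>.\<close>

lemma safe_start:
  assumes "E w v" "c \<in> N" "v \<notin> ends c"
  shows "safe w v 1 c"
proof (cases c)
  case (Gad x a)
  with assms h_le_K K_pos show ?thesis
    by (auto simp: safe_def far0_def L_def)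
next
  case (Half x y i)
  with assms h_le_K K_pos show ?thesis
    by (auto simp: safe_def far0_def L_def)
qed

lemma next_move:
  assumes "E v u" "on_route v u (Suc n) r" "\<And>c. c \<in> D \<Longrightarrow> c \<in> N \<and> safe v u (Suc n) c"
  shows "\<exists>(v, u, n, r')\<in>{(v, u, n, r). E v u \<and> on_route v u n r}.
    R r r' \<and> (\<forall>c\<in>D. c \<in> N \<and> safe v u (Suc n) c)"
proof -
  obtain r' where "on_route v u n r'" "R r r'"
    using on_route_step assms(1,2) by blast
  with assms show ?thesis
    by (intro bexI[of _ "(v, u, n, r')"]) auto
qed

text \<open>At \<open>n = 0\<close> the same position is reinterpreted as the start of a run towards
  a new neighbour, and the first step of that run is taken at once.\<close>

lemma robber_move:
  assumes "E v u" "on_route v u n r" "finite D" "card D \<le> k" "\<And>c. c \<in> D \<Longrightarrow> c \<in> N \<and> safe v u n c"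
  shows "\<exists>(v, u, n, r')\<in>{(v, u, n, r). E v u \<and> on_route v u n r}.
    R r r' \<and> (\<forall>c\<in>D. c \<in> N \<and> safe v u (Suc n) c)"
proof (cases n)
  case 0
  have r: "r = Gad u (port u v)"
    using assms(2) 0 by (cases r) (auto simp: L_def)
  obtain u' where u': "E u u'" "u' \<noteq> v" "\<And>c x. c \<in> D \<Longrightarrow> x \<in> ends c \<Longrightarrow> u' \<notin> threatened u x"
    using unthreatened_neighbour[OF E_V2[OF assms(1)] assms(3,4), of v] by blast
  let ?n = "2 * K + gd (port u v) (port u u')"
  have L: "Suc ?n = L + gd (port u v) (port u u')"
    by (simp add: L_def)
  have "safe u u' (Suc ?n) c" if "c \<in> D" for c
    unfolding L
  proof (rule safe_unthreatened[OF assms(1) u'(1)])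
    show "c \<in> N" "h + 1 \<le> far v u c"
      using assms(5)[OF that] 0 by (simp_all add: safe_def)
  qed (use u' that in auto)
  moreover have "on_route u u' (Suc ?n) r"
    using port_A[OF E_sym[OF assms(1)]] by (simp add: r L)
  ultimately show ?thesis
    using assms(5) u'(1) by (intro next_move) auto
next
  case (Suc n')
  with assms show ?thesis
    by (intro next_move) auto
qed

section \<open>Escape from \<open>k\<close> cops, and connectedness of the gadget graph\<close>

lemma not_cops_win_H:
  assumes "j \<le> k"
  shows "\<not> cops_win H j"
proof -
  let ?valid = "\<lambda>(v, u, n, r). E v u \<and> on_route v u n r"
  let ?pos = "\<lambda>(v :: nat, u :: nat, n :: nat, r :: node). r"
  \<comment> \<open>The extra \<open>Suc\<close> is the margin that the pending cop move may use
    up.\<close>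
  let ?Q = "\<lambda>(v, u, n, r :: node) c. c \<in> N \<and> safe v u (Suc n) c"
  let ?Q' = "\<lambda>(v, u, n, r :: node) c. safe v u n c"
  show ?thesis
  proof (rule not_cops_win_coded_graph[where valid = ?valid and pos = ?pos and Q = ?Q and Q' = ?Q',
        OF _ _ _ _ _ assms])
    show "?pos m \<in> N" if "?valid m" for m
      using that by (cases m) (auto intro: on_route_N)
    show "?Q' m b" if "?valid m" "?Q m a" "a \<in> N" "b \<in> N" "a = b \<or> R a b" for m a b
      using that safe_cop_move[of _ _ a b] by (cases m) simp
    show "\<exists>m'. ?valid m' \<and> R (?pos m) (?pos m') \<and> (\<forall>c\<in>D. ?Q m' c)"
      if "?valid m" "D \<subseteq> N" "finite D" "card D \<le> k" "\<And>c. c \<in> D \<Longrightarrow> ?Q' m c" for m D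
    proof -
      obtain v u n r where m: "m = (v, u, n, r)"
        by (cases m)
      have "E v u" "on_route v u n r" "\<And>c. c \<in> D \<Longrightarrow> c \<in> N \<and> safe v u n c"
        using that(1,2,5) by (auto simp: m)
      from robber_move[OF this(1,2) that(3,4) this(3)] show ?thesis
        by (auto simp: m)
    qed
    show "\<not> ?Q' m (?pos m)" if "?valid m" for m
      using that on_route_not_safe by (cases m) simp
    show "\<exists>m. ?valid m \<and> (\<forall>c\<in>D. ?Q m c)" if D: "D \<subseteq> N" "finite D" "card D \<le> k" for D
    proof -
      obtain v where v: "v \<in> V" "\<And>c. c \<in> D \<Longrightarrow> v \<notin> ends c"
        using start_vertex[OF D(2,3)] by blast
      obtain w where w: "E v w"
        using unthreatened_neighbour[OF v(1), of "{}"] by auto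
      have "on_route w v 0 (Gad v (port v w))"
        using port_A[OF w] by simp
      moreover have "safe w v (Suc 0) c" if "c \<in> D" for c
        using safe_start[OF E_sym[OF w]] v(2) that D(1) by auto
      ultimately show ?thesis
        using E_sym[OF w] D(1) by (intro exI[of _ "(w, v, 0, Gad v (port v w))"]) auto
    qed
  qed
qed

lemma cop_number_H: "k < cop_number H"
  using not_cops_win_H by (intro cop_number_gt) (auto simp: finite_N)

lemma connected_H: "connected_graph H"
proof (rule connected_coded_graph)
  let ?R = "\<lambda>s t. s \<in> N \<and> t \<in> N \<and> R s t"
  have "symp ?R"
    using symp_R by (auto simp: symp_def)
  then have sym: "?R\<^sup>*\<^sup>* t s" if "?R\<^sup>*\<^sup>* s t" for s t
    using that by (metis symp_rtranclp sympD)
  have link: "?R\<^sup>*\<^sup>* s t" if "s \<in> N" "t \<in> N" "R s t" for s t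
    using that by auto
  have trans: "?R\<^sup>*\<^sup>* s u" if "?R\<^sup>*\<^sup>* s t" "?R\<^sup>*\<^sup>* t u" for s t u
    using that by (rule rtranclp_trans)
  have gad: "?R\<^sup>*\<^sup>* (Gad x a) (Gad x b)" if x: "x \<in> V" and b: "b \<in> A" and "a \<in> A" for x a b
    using that(3)
  proof (induction "gd a b" arbitrary: a)
    case 0
    then show ?case
      using gd_0[of a b] by simp
  next
    case (Suc n)
    then obtain c where c: "c \<in> A" "gd a c = 1" "gd c b = n"
      using gd_Suc[of a b n] b by auto
    show ?case
    proof (rule trans)
      show "?R\<^sup>*\<^sup>* (Gad x a) (Gad x c)"
        using c x Suc.prems by (intro link) simp_all
      show "?R\<^sup>*\<^sup>* (Gad x c) (Gad x b)"
        using Suc.hyps(1) c by simp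
    qed
  qed
  have half: "?R\<^sup>*\<^sup>* (Gad x (port x y)) (Half x y (Suc i))" if xy: "E x y" and "Suc i \<le> K" for x y i
    using that(2)
  proof (induction i)
    case 0
    then show ?case
      using xy E_V[OF xy] port_A[OF xy] by (intro link) simp_all
  next
    case (Suc i)
    show ?case
    proof (rule trans)
      show "?R\<^sup>*\<^sup>* (Gad x (port x y)) (Half x y (Suc i))"
        using Suc by simp
      show "?R\<^sup>*\<^sup>* (Half x y (Suc i)) (Half x y (Suc (Suc i)))"
        using Suc.prems xy by (intro link) simp_all
    qed
  qed
  have gad_half: "?R\<^sup>*\<^sup>* (Gad x a) (Half x y i)" if "E x y" "a \<in> A" "1 \<le> i" "i \<le> K" for x y a i
  proof (rule trans)
    show "?R\<^sup>*\<^sup>* (Gad x a) (Gad x (port x y))"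
      using that E_V port_A by (intro gad)
    show "?R\<^sup>*\<^sup>* (Gad x (port x y)) (Half x y i)"
      using half[OF that(1), of "i - 1"] that(3,4) by simp
  qed
  have edge: "?R\<^sup>*\<^sup>* (Gad x a) (Gad y b)" if xy: "E x y" and ab: "a \<in> A" "b \<in> A" for x y a b
  proof (rule trans[OF trans])
    show "?R\<^sup>*\<^sup>* (Gad x a) (Half x y K)"
      using xy ab K_pos by (intro gad_half) simp_all
    have "x \<noteq> y"
      using xy E_irrefl by blast
    then show "?R\<^sup>*\<^sup>* (Half x y K) (Half y x K)"
      using xy E_sym[OF xy] K_pos by (intro link) simp_all
    show "?R\<^sup>*\<^sup>* (Half y x K) (Gad y b)"
      using E_sym[OF xy] ab K_pos by (intro sym[OF gad_half]) simp_all
  qed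
  have gads: "?R\<^sup>*\<^sup>* (Gad x a) (Gad y b)" if xy: "x \<in> V" "y \<in> V" and a: "a \<in> A" and b: "b \<in> A" for x y a b
    using connected[OF xy] b
  proof (induction arbitrary: b)
    case base
    then show ?case
      using gad xy a by blast
  next
    case (step y z)
    show ?case
      using step.IH[OF step.prems] edge[OF step.hyps(2) step.prems step.prems] by (rule trans)
  qed
  have to_gad: "\<exists>x\<in>V. \<exists>a\<in>A. ?R\<^sup>*\<^sup>* (Gad x a) s" if "s \<in> N" for s
  proof (cases s)
    case (Gad x a)
    with that show ?thesis
      by auto
  next
    case (Half x y i)
    with that show ?thesis
      using gad_half[of x y "port x y" i] E_V port_A
      by (intro bexI[of _ x] bexI[of _ "port x y"]) auto
  qed
  show "?R\<^sup>*\<^sup>* s t" if "s \<in> N" "t \<in> N" for s t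
  proof -
    obtain x a where x: "x \<in> V" "a \<in> A" "?R\<^sup>*\<^sup>* (Gad x a) s"
      using to_gad[OF \<open>s \<in> N\<close>] by blast
    obtain y b where y: "y \<in> V" "b \<in> A" "?R\<^sup>*\<^sup>* (Gad y b) t"
      using to_gad[OF \<open>t \<in> N\<close>] by blast
    show ?thesis
      using trans[OF trans[OF sym[OF x(3)] gads[OF x(1) y(1) x(2) y(2)]] y(3)] .
  qed
  obtain x where "x \<in> V"
    using V_nonempty by blast
  then obtain y where "E x y"
    using unthreatened_neighbour[of x "{}"] by auto
  then have "Half x y 1 \<in> N"
    using K_pos by simp
  then show "N \<noteq> {}"
    by blast
qed

end

section \<open>Line graphs and axis-parallel segments\<close>

lemma line_graphs_coded_graph:
  fixes f :: "'a::countable \<Rightarrow> nat set"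
  assumes "finite N" "symp R" "irreflp R" "inj_on f N" "\<And>a. a \<in> N \<Longrightarrow> card (f a) = 2"
    and "\<And>a b. a \<in> N \<Longrightarrow> b \<in> N \<Longrightarrow> a \<noteq> b \<Longrightarrow> R a b \<longleftrightarrow> f a \<inter> f b \<noteq> {}"
  shows "coded_graph N R \<in> line_graphs"
proof -
  have "is_line_graph (coded_graph N R)"
    unfolding is_line_graph_def
  proof (intro exI[of _ "f ` N"] exI[of _ "f \<circ> from_nat"] conjI ballI)
    show "finite (f ` N)"
      using assms(1) by simp
    show "card e = 2" if "e \<in> f ` N" for e
      using that assms(5) by blast
    show "bij_betw (f \<circ> from_nat) (verts (coded_graph N R)) (f ` N)"
      using assms(4) by (auto simp: bij_betw_def inj_on_def image_comp comp_def)
    show "adj (coded_graph N R) u v \<longleftrightarrow> u \<noteq> v \<and> (f \<circ> from_nat) u \<inter> (f \<circ> from_nat) v \<noteq> {}"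
      if uv: "u \<in> verts (coded_graph N R)" "v \<in> verts (coded_graph N R)" for u v
    proof -
      obtain a b where "a \<in> N" "u = to_nat a" "b \<in> N" "v = to_nat b"
        using uv unfolding verts_coded_graph by blast
      then show ?thesis
        using assms(6)[of a b] irreflpD[OF assms(3), of a] by (cases "a = b") auto
    qed
  qed
  with assms(1-3) show ?thesis
    by (simp add: line_graphs_def wf_coded_graph)
qed

lemma min_max_eq_iff:
  fixes x y :: "'a::linorder"
  shows "min x y = min x' y' \<and> max x y = max x' y' \<longleftrightarrow> x = x' \<and> y = y' \<or> x = y' \<and> y = x'"
  by (auto simp: min_def max_def)

text \<open>The line graph of the base graph with every edge subdivided three times and with some pendant
  edges added: each gadget is the clique of the edges at an original vertex.\<close>
fun line_edge :: "node \<Rightarrow> nat set" where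
  "line_edge (Gad x a) = to_nat ` {(0::nat, x, 0::nat), (1, x, a)}"
| "line_edge (Half x y i) = to_nat ` {(1::nat, x, y), (2, min x y, max x y)}"

lemma max_cn_line_graphs: "max_cn line_graphs = \<infinity>"
proof (rule max_cn_eq_infinity)
  fix k
  obtain V E where "base_graph V E k"
    using base_graph_exists by blast
  then interpret base_graph V E k .
  \<comment> \<open>Clique gadgets: the discrete metric on \<open>V\<close>, a separate port for
    each neighbour, and one inner vertex per half path.\<close>
  interpret gadget_graph V E k V "\<lambda>a b. if a = b then 0 else 1" "\<lambda>x y. y" "Suc 0" "Suc 0"
  proof unfold_locales
    show "\<exists>b\<in>V. (if a = b then 0 else 1) = 1 \<and> (if b = c then 0 else 1) = n"
      if "c \<in> V" "(if a = c then 0 else 1) = Suc n" for a c n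
      using that by (intro bexI[of _ c]) (auto split: if_splits)
  qed (auto simp: finite_V E_V2)
  have to_nat_image: "to_nat ` P \<inter> to_nat ` Q \<noteq> {} \<longleftrightarrow> P \<inter> Q \<noteq> {}" for P Q :: "(nat \<times> nat \<times> nat) set"
    by auto
  have "H \<in> line_graphs"
  proof (rule line_graphs_coded_graph[OF finite_N symp_R irreflp_R])
    show "card (line_edge s) = 2" for s
      by (cases s) auto
    show "R s t \<longleftrightarrow> line_edge s \<inter> line_edge t \<noteq> {}" if "s \<in> N" "t \<in> N" "s \<noteq> t" for s t
    proof (cases s; cases t)
      fix x y i x' y' j assume "s = Half x y i" "t = Half x' y' j"
      moreover have "x \<noteq> y" if "E x y"
        using that E_irrefl by blast
      ultimately show ?thesis
        using that by (auto simp: to_nat_image min_max_eq_iff simp del: image_insert)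
    qed (use that in \<open>auto simp: to_nat_image simp del: image_insert\<close>)
    show "inj_on line_edge N"
    proof (rule inj_onI)
      \<comment> \<open>\<open>line_edge\<close> ignores the index of a \<open>Half\<close>, which
        is always 1 because \<open>K\<close> is 1.\<close>
      fix s t assume "s \<in> N" "t \<in> N" "line_edge s = line_edge t"
      then have "line_edge s = line_edge t" "\<exists>x a. s = Gad x a \<or> s = Half x a 1" "\<exists>x a. t = Gad x a \<or> t = Half x a 1"
        by (cases s; cases t; auto)+
      then show "s = t"
        by (auto simp: inj_image_eq_iff doubleton_eq_iff simp del: image_insert)
    qed
  qed
  with connected_H cop_number_H show "\<exists>G\<in>line_graphs. connected_graph G \<and> k < cop_number G"
    by blast
qed

section \<open>Boxes and axis-parallel segments in space\<close>

lemma exists_3: "(\<exists>i::3. P i) \<longleftrightarrow> P 1 \<or> P 2 \<or> P 3"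
  using forall_3[of "\<lambda>i. \<not> P i"] by blast

definition box3 :: "real \<Rightarrow> real \<Rightarrow> real \<Rightarrow> real \<Rightarrow> real \<Rightarrow> real \<Rightarrow> (real^3) set" where
  "box3 x x' y y' z z' = cbox (vector [x, y, z]) (vector [x', y', z'])"

lemma box3_meet_iff:
  "box3 x x' y y' z z' \<inter> box3 u u' v v' w w' \<noteq> {} \<longleftrightarrow>
    max x u \<le> min x' u' \<and> max y v \<le> min y' v' \<and> max z w \<le> min z' w'"
proof -
  have "box3 x x' y y' z z' \<inter> box3 u u' v v' w w' =
      cbox (vector [max x u, max y v, max z w]) (vector [min x' u', min y' v', min z' w'])"
    by (auto simp: box3_def mem_box_cart forall_3)
  then show ?thesis
    by (auto simp: interval_ne_empty_cart forall_3)
qed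

lemma box3_eq_iff:
  assumes "x \<le> x'" "y \<le> y'" "z \<le> z'"
  shows "box3 x x' y y' z z' = box3 u u' v v' w w' \<longleftrightarrow>
    x = u \<and> x' = u' \<and> y = v \<and> y' = v' \<and> z = w \<and> z' = w'"
proof -
  have "cbox (vector [x, y, z]) (vector [x', y', z'] :: real^3) \<noteq> {}"
    using assms by (simp add: interval_ne_empty_cart forall_3)
  then show ?thesis
    by (auto simp: box3_def eq_cbox vec_eq_iff forall_3)
qed

lemma box3_axis_segment:
  assumes "x < x' \<and> y = y' \<and> z = z' \<or> x = x' \<and> y < y' \<and> z = z' \<or> x = x' \<and> y = y' \<and> z < z'"
  shows "box3 x x' y y' z z' \<in> axis_segments3"
proof -
  let ?p = "vector [x, y, z] :: real^3" and ?q = "vector [x', y', z'] :: real^3"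
  have "\<exists>i. ?p$i < ?q$i \<and> (\<forall>j. j \<noteq> i \<longrightarrow> ?p$j = ?q$j)"
    using assms by (auto simp: exists_3 forall_3)
  then obtain i where i: "?p$i < ?q$i" "\<And>j. j \<noteq> i \<Longrightarrow> ?p$j = ?q$j"
    by blast
  then have "box3 x x' y y' z z' = closed_segment ?p ?q"
    using closed_segment_eq_cbox_cart[of ?p i ?q] by (simp add: box3_def)
  moreover have "?p \<noteq> ?q"
    using i(1) by auto
  ultimately show ?thesis
    unfolding axis_segments3_def using i(2) by blast
qed

text \<open>A number for the unordered pair, so that both halves of an edge share it.\<close>

definition code :: "nat \<Rightarrow> nat \<Rightarrow> nat" where
  "code x y = prod_encode (min x y, max x y)"

lemma code_eq_iff: "code x y = code x' y' \<longleftrightarrow> x = x' \<and> y = y' \<or> x = y' \<and> y = x'"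
  using min_max_eq_iff[of x y x' y'] by (simp add: code_def)

lemma code_bounded:
  assumes "finite V"
  shows "\<exists>M. \<forall>x\<in>V. \<forall>y\<in>V. code x y < M"
proof -
  have "finite ((\<lambda>(x, y). code x y) ` (V \<times> V))"
    using assms by simp
  then obtain M where "\<forall>n\<in>(\<lambda>(x, y). code x y) ` (V \<times> V). n < M"
    unfolding finite_nat_set_iff_bounded by blast
  then show ?thesis
    by auto
qed

text \<open>Every vertex \<open>x\<close> is a long segment in the first direction over the point \<open>(x, x)\<close> of the
  diagonal; the edge \<open>xy\<close> runs in a plane of its own, where an L-shaped path of two segments joins
  the diagonal points \<open>(x, x)\<close> and \<open>(y, y)\<close>.\<close>
fun node_box :: "nat \<Rightarrow> node \<Rightarrow> (real^3) set" where
  "node_box M (Gad x a) = box3 0 M x x x x"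
| "node_box M (Half x y i) =
    (if x < y then box3 (code x y) (code x y) x y x x else box3 (code x y) (code x y) x x y x)"

lemma max_cn_axis_segments3: "max_cn (intersection_class axis_segments3) = \<infinity>"
proof (rule max_cn_eq_infinity)
  fix k
  obtain V E where "base_graph V E k"
    using base_graph_exists by blast
  then interpret base_graph V E k .
  \<comment> \<open>One-vertex gadgets; since \<open>gd_0\<close> ranges over all naturals,
    \<open>gd\<close> is the distance on the naturals, written with truncated differences.\<close>
  interpret gadget_graph V E k "{0}" "\<lambda>a b. (a - b) + (b - a)" "\<lambda>_ _. 0" 0 "Suc 0"
    by unfold_locales auto
  obtain M where M: "\<And>x y. x \<in> V \<Longrightarrow> y \<in> V \<Longrightarrow> code x y < M"
    using code_bounded[OF finite_V] by blast
  have M_pos: "0 < M"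
    using M V_nonempty by fastforce
  have edge: "x \<noteq> y" "code x y < M" if "E x y" for x y
    using that E_irrefl E_V E_V2 M by blast+
  have "H \<in> intersection_class axis_segments3"
  proof (rule intersection_class_coded_graph[OF finite_N symp_R irreflp_R])
    show "node_box M ` N \<subseteq> axis_segments3"
    proof
      fix S assume "S \<in> node_box M ` N"
      then obtain s where "s \<in> N" "S = node_box M s"
        by blast
      then show "S \<in> axis_segments3"
        using M_pos edge(1) by (cases s) (auto intro!: box3_axis_segment simp: not_less_iff_gr_or_eq)
    qed
    have meet: "R s t \<longleftrightarrow> node_box M s \<inter> node_box M t \<noteq> {}"
      if "s \<in> N" "t \<in> N" "s \<noteq> t" for s t
    proof (cases s; cases t)
      fix x a y b assume "s = Gad x a" "t = Gad y b"
      then show ?thesis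
        using that by (auto simp: box3_meet_iff)
    next
      fix x a y z i assume st: "s = Gad x a" "t = Half y z i"
      then show ?thesis
        using that edge[of y z] by (cases "y < z") (auto simp: box3_meet_iff)
    next
      fix x a y z i assume st: "s = Half y z i" "t = Gad x a"
      then show ?thesis
        using that edge[of y z] by (cases "y < z") (auto simp: box3_meet_iff)
    next
      fix x y i x' y' j assume st: "s = Half x y i" "t = Half x' y' j"
      then have ij: "i = 1" "j = 1" "x \<noteq> y" "x' \<noteq> y'"
        using that edge by auto
      show ?thesis
      proof (cases "code x y = code x' y'")
        case True
        then have "x' = y" "y' = x"
          using that ij by (auto simp: st code_eq_iff)
        \<comment> \<open>The two halves meet at the corner \<open>(max x y, min x y)\<close> of
          their plane.\<close>
        with True ij show ?thesis
          by (cases "x < y") (auto simp: st box3_meet_iff)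
      next
        case False
        then have "\<not> (x = y' \<and> y = x')" "\<not> (x = x' \<and> y = y')"
          by (auto simp: code_eq_iff)
        with ij have "\<not> R s t"
          by (auto simp: st)
        moreover have "node_box M s \<inter> node_box M t = {}"
        proof (rule ccontr)
          assume "node_box M s \<inter> node_box M t \<noteq> {}"
          then have "real (code x y) = real (code x' y')"
            by (simp add: st box3_meet_iff split: if_splits)
          with False show False
            by simp
        qed
        ultimately show ?thesis
          by blast
      qed
    qed
    then show "R s t \<longleftrightarrow> node_box M s \<inter> node_box M t \<noteq> {}"
      if "s \<in> N" "t \<in> N" "s \<noteq> t" for s t
      using that .
    show "inj_on (node_box M) N"
    proof (rule inj_onI)
      fix s t assume st: "s \<in> N" "t \<in> N" and eq: "node_box M s = node_box M t"
      show "s = t"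
      \<comment> \<open>Equal nonempty boxes intersect, so \<open>s\<close> and \<open>t\<close>
        would be adjacent, but adjacent nodes have different boxes.\<close>
      proof (rule ccontr)
        assume "s \<noteq> t"
        have "node_box M s \<noteq> {}"
          using st by (cases s) (auto simp: box3_def interval_eq_empty_cart exists_3)
        with eq meet[OF st \<open>s \<noteq> t\<close>] have "R s t"
          by simp
        then show False
          using st eq edge by (cases s; cases t) (auto simp: box3_eq_iff split: if_splits)
      qed
    qed
  qed
  with connected_H cop_number_H
  show "\<exists>G\<in>intersection_class axis_segments3. connected_graph G \<and> k < cop_number G"
    by blast
qed

section \<open>Unit balls and unit cubes\<close>

fun l1_dist :: "int \<times> int \<times> int \<Rightarrow> int \<times> int \<times> int \<Rightarrow> int" where
  "l1_dist (a, b, c) (a', b', c') = \<bar>a - a'\<bar> + \<bar>b - b'\<bar> + \<bar>c - c'\<bar>"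

lemma l1_dist_sym: "l1_dist u v = l1_dist v u"
  by (cases u; cases v) simp

text \<open>The plane that contains the half of the edge \<open>xy\<close> at \<open>x\<close>. The two halves of an edge lie in
  adjacent planes, and distinct edges use planes that are not adjacent.\<close>
definition plane :: "nat \<Rightarrow> nat \<Rightarrow> nat" where
  "plane x y = 3 * code x y + (if x < y then 0 else 1)"

lemma plane_cases:
  obtains (same) "x' = x" "y' = y" | (reverse) "x' = y" "y' = x" "x \<noteq> y"
  | (apart) "2 \<le> \<bar>int (plane x y) - int (plane x' y')\<bar>" "\<not> (x' = y \<and> y' = x)" "\<not> (x' = x \<and> y' = y)"
proof (cases "code x y = code x' y'")
  case True
  then show ?thesis
    using same reverse by (auto simp: code_eq_iff)
next
  case False
  then have "code x y < code x' y' \<or> code x' y' < code x y"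
    by linarith
  \<comment> \<open>The codes contribute at least 3, and the choice of half takes away at most
    1.\<close>
  then have "2 \<le> \<bar>int (plane x y) - int (plane x' y')\<bar>"
    unfolding plane_def by (auto split: if_split)
  then show ?thesis
    using False apart by (auto simp: code_eq_iff)
qed

text \<open>\<open>gap\<close> is the number of horizontal steps from the column over \<open>x\<close> to the midpoint of the edge
  \<open>xy\<close>; the columns are as high as needed to give all edges the same length.\<close>
definition gap :: "nat \<Rightarrow> nat \<Rightarrow> nat" where
  "gap x y = (x - y) + (y - x)"

text \<open>A gadget is a bar at height 0; a half path climbs \<open>K - gap x y\<close> steps and
  then runs sideways, the truncated difference being 0 during the climb. The factor 2 separates the
  bars and puts the midpoint at the integer \<open>x + y\<close>.\<close>

fun grid :: "nat \<Rightarrow> node \<Rightarrow> int \<times> int \<times> int" where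
  "grid K (Gad x a) = (int a, 2 * int x, 0)"
| "grid K (Half x y i) = (int (plane x y),
     if x < y then 2 * int x + int (i - (K - gap x y)) else 2 * int x - int (i - (K - gap x y)),
     int (min i (K - gap x y)))"

text \<open>By \<open>gap_le\<close> every column between vertices of \<open>V\<close> is at least 2
  high, which keeps the horizontal runs away from the bars.\<close>

locale grid_embedding = base_graph +
  fixes M K :: nat
  assumes plane_le: "x \<in> V \<Longrightarrow> y \<in> V \<Longrightarrow> plane x y \<le> M"
    and gap_le: "x \<in> V \<Longrightarrow> y \<in> V \<Longrightarrow> gap x y + 2 \<le> K"
    and M_le_K: "M \<le> K"
begin

text \<open>Path gadgets: \<open>gap\<close> also serves as the metric of the bar, and plane numbers
  serve as ports.\<close>

sublocale gadget_graph V E k "{..M}" gap plane M K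
proof unfold_locales
  show "gap a b = 0 \<longleftrightarrow> a = b" "gap a b = gap b a" for a b
    by (auto simp: gap_def)
  show "gap a c \<le> gap a b + gap b c" for a b c
    by (simp add: gap_def)
  show "gap a b \<le> M" if "a \<in> {..M}" "b \<in> {..M}" for a b
    using that by (simp add: gap_def)
  show "\<exists>b\<in>{..M}. gap a b = 1 \<and> gap b c = n"
    if "a \<in> {..M}" "c \<in> {..M}" "gap a c = Suc n" for a c n
  proof (cases "a < c")
    case True
    with that show ?thesis
      by (intro bexI[of _ "Suc a"]) (auto simp: gap_def)
  next
    case False
    with that show ?thesis
      by (intro bexI[of _ "a - 1"]) (auto simp: gap_def)
  qed
  show "plane x y \<in> {..M}" if "E x y" for x y
    using plane_le E_V[OF that] E_V2[OF that] by simp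
  show "0 < K"
    using V_nonempty gap_le by fastforce
qed (use M_le_K in simp_all)

lemma edge_gap:
  assumes "E x y"
  shows "x \<noteq> y" "gap x y + 2 \<le> K"
  using assms E_irrefl gap_le[OF E_V[OF assms] E_V2[OF assms]] by auto

lemma l1_dist_Gad_Half:
  assumes "E y z" "1 \<le> i"
  shows "R (Gad x a) (Half y z i) \<Longrightarrow> l1_dist (grid K (Gad x a)) (grid K (Half y z i)) = 1"
    and "\<not> R (Gad x a) (Half y z i) \<Longrightarrow> 2 \<le> l1_dist (grid K (Gad x a)) (grid K (Half y z i))"
proof -
  have gap: "gap y z + 2 \<le> K"
    using edge_gap[OF assms(1)] by blast
  show "l1_dist (grid K (Gad x a)) (grid K (Half y z i)) = 1" if "R (Gad x a) (Half y z i)"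
    using that gap by auto
  show "2 \<le> l1_dist (grid K (Gad x a)) (grid K (Half y z i))" if not_R: "\<not> R (Gad x a) (Half y z i)"
  proof (cases "i = 1")
    case False
    then have "2 \<le> int (min i (K - gap y z))"
      using gap assms(2) by simp
    then show ?thesis
      unfolding grid.simps l1_dist.simps by linarith
  next
    case True
    then have "grid K (Half y z i) = (int (plane y z), 2 * int y, 1)"
      using gap by simp
    moreover have "1 \<le> \<bar>int a - int (plane y z)\<bar> \<or> 1 \<le> \<bar>2 * int x - 2 * int y\<bar>"
      using not_R True by auto
    ultimately show ?thesis
      by auto
  qed
qed

text \<open>A half is a monotone lattice path: the sideways part \<open>i - m\<close> and the climb
  \<open>min i m\<close> add up to \<open>i\<close>.\<close>

lemma l1_dist_Half_same:
  "l1_dist (grid K (Half x y i)) (grid K (Half x y j)) = \<bar>int i - int j\<bar>"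
proof -
  have steps: "\<bar>int (i - m) - int (j - m)\<bar> + \<bar>int (min i m) - int (min j m)\<bar> = \<bar>int i - int j\<bar>" for m
    by (cases "i \<le> m"; cases "j \<le> m") simp_all
  have "\<bar>p - p\<bar> + \<bar>q + a - (q + b)\<bar> + w = \<bar>a - b\<bar> + w"
    "\<bar>p - p\<bar> + \<bar>q - a - (q - b)\<bar> + w = \<bar>a - b\<bar> + w" for p q a b w :: int
    by (simp_all add: abs_minus_commute)
  then show ?thesis
    unfolding grid.simps l1_dist.simps by (cases "x < y") (simp_all only: if_True if_False steps)
qed

text \<open>One summand per coordinate: the planes are adjacent, the columns are
  \<open>2 * gap x y\<close> apart less the steps made towards each other, and the heights differ by
  the last term.\<close>

lemma l1_dist_Half_reverse:
  assumes "E x y" "i \<le> K" "j \<le> K"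
  defines "m \<equiv> K - gap x y"
  shows "l1_dist (grid K (Half x y i)) (grid K (Half y x j)) =
    1 + (2 * int (gap x y) - int (i - m) - int (j - m)) + \<bar>int (min i m) - int (min j m)\<bar>"
proof -
  have gap: "gap y x = gap x y"
    by (simp add: gap_def)
  have "x < y \<or> y < x"
    using edge_gap(1)[OF assms(1)] by linarith
  moreover have "code y x = code x y"
    by (simp add: code_eq_iff)
  ultimately have planes: "\<bar>int (plane x y) - int (plane y x)\<bar> = 1"
    by (auto simp: plane_def)
  have half: "i - m \<le> gap x y" "j - m \<le> gap x y"
    using edge_gap(2)[OF assms(1)] assms(2,3) unfolding m_def by linarith+
  have sum: "p + \<bar>2 * u + a - (2 * v - b)\<bar> + w = 1 + (2 * g - a - b) + w"
    "p + \<bar>2 * v - a - (2 * u + b)\<bar> + w = 1 + (2 * g - a - b) + w"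
    if "p = 1" "a \<le> g" "b \<le> g" "g = v - u" for p u v a b g w :: int
    using that by simp_all
  from \<open>x < y \<or> y < x\<close> show ?thesis
  proof
    assume "x < y"
    then have if_conds: "(x < y) = True" "(y < x) = False" and "int (gap x y) = int y - int x"
      by (auto simp: gap_def)
    with planes half show ?thesis
      unfolding grid.simps l1_dist.simps gap m_def[symmetric] if_conds if_True if_False
      by (intro sum(1)) simp_all
  next
    assume "y < x"
    then have if_conds: "(x < y) = False" "(y < x) = True" and "int (gap x y) = int x - int y"
      by (auto simp: gap_def)
    with planes half show ?thesis
      unfolding grid.simps l1_dist.simps gap m_def[symmetric] if_conds if_True if_False
      by (intro sum(2)) simp_all
  qed
qed

lemma l1_dist_Half_Half:
  assumes "E x y" "1 \<le> i" "i \<le> K" "E x' y'" "1 \<le> j" "j \<le> K"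
  shows "R (Half x y i) (Half x' y' j) \<Longrightarrow> l1_dist (grid K (Half x y i)) (grid K (Half x' y' j)) = 1"
    and "\<not> R (Half x y i) (Half x' y' j) \<Longrightarrow> Half x y i \<noteq> Half x' y' j \<Longrightarrow>
      2 \<le> l1_dist (grid K (Half x y i)) (grid K (Half x' y' j))"
proof -
  define d where "d = l1_dist (grid K (Half x y i)) (grid K (Half x' y' j))"
  let ?R = "R (Half x y i) (Half x' y' j)"
  have xy: "x \<noteq> y"
    using edge_gap(1)[OF assms(1)] .
  have "(?R \<longrightarrow> d = 1) \<and> (\<not> ?R \<longrightarrow> Half x y i \<noteq> Half x' y' j \<longrightarrow> 2 \<le> d)"
  proof (rule plane_cases[of x' x y' y])
    assume eq: "x' = x" "y' = y"
    have "d = \<bar>int i - int j\<bar>"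
      unfolding d_def eq by (rule l1_dist_Half_same)
    moreover have "?R \<longleftrightarrow> i = Suc j \<or> j = Suc i"
      using xy by (auto simp: eq)
    ultimately show ?thesis
      unfolding eq by auto
  next
    assume eq: "x' = y" "y' = x" "x \<noteq> y"
    define m where "m = K - gap x y"
    have m: "m + gap x y = K" "0 < gap x y"
      using edge_gap[OF assms(1)] by (auto simp: m_def gap_def)
    have d: "d = 1 + (2 * int (gap x y) - int (i - m) - int (j - m)) + \<bar>int (min i m) - int (min j m)\<bar>"
      unfolding d_def eq m_def by (rule l1_dist_Half_reverse[OF assms(1,3,6)])
    have R: "?R \<longleftrightarrow> i = K \<and> j = K"
      using eq by auto
    show ?thesis
    proof (cases "i = K \<and> j = K")
      case True
      then have "i - m = gap x y" "j - m = gap x y" "i = j"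
        using m(1) by auto
      then have "d = 1"
        unfolding d by simp
      with True R show ?thesis
        by simp
    next
      case False
      then have "i < K \<or> j < K"
        using assms(3,6) by auto
      \<comment> \<open>A half completes its sideways run only at index \<open>K\<close>, so
        otherwise a horizontal distance of at least 1 adds to that of the planes.\<close>
      then have "i - m + (j - m) < 2 * gap x y"
        using m assms(3,6) by (elim disjE) simp_all
      then have "int (i - m) + int (j - m) < 2 * int (gap x y)"
        by (simp flip: of_nat_add of_nat_mult)
      moreover have "2 \<le> 1 + (g - a - b) + \<bar>w\<bar>" if "a + b < g" for a b g w :: int
        using that by linarith
      ultimately have "2 \<le> d"
        unfolding d by blast
      with False R show ?thesis
        by simp
    qed
  next
    assume apart: "2 \<le> \<bar>int (plane x y) - int (plane x' y')\<bar>" "\<not> (x' = y \<and> y' = x)" "\<not> (x' = x \<and> y' = y)"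
    have "2 \<le> \<bar>p\<bar> + \<bar>q\<bar> + \<bar>r\<bar>" if "2 \<le> \<bar>p\<bar>" for p q r :: int
      using that by linarith
    with apart(1) have "2 \<le> d"
      unfolding d_def grid.simps l1_dist.simps by blast
    moreover have "\<not> ?R"
      using apart(2,3) by auto
    ultimately show ?thesis
      by blast
  qed
  then show "?R \<Longrightarrow> l1_dist (grid K (Half x y i)) (grid K (Half x' y' j)) = 1"
    "\<not> ?R \<Longrightarrow> Half x y i \<noteq> Half x' y' j \<Longrightarrow> 2 \<le> l1_dist (grid K (Half x y i)) (grid K (Half x' y' j))"
    unfolding d_def by blast+
qed

lemma l1_dist_grid:
  assumes "s \<in> N" "t \<in> N"
  shows "R s t \<Longrightarrow> l1_dist (grid K s) (grid K t) = 1"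
    and "\<not> R s t \<Longrightarrow> s \<noteq> t \<Longrightarrow> 2 \<le> l1_dist (grid K s) (grid K t)"
proof -
  have "(R s t \<longrightarrow> l1_dist (grid K s) (grid K t) = 1) \<and>
    (\<not> R s t \<longrightarrow> s \<noteq> t \<longrightarrow> 2 \<le> l1_dist (grid K s) (grid K t))"
  proof (cases s; cases t)
    fix x a y b assume st: "s = Gad x a" "t = Gad y b"
    have "gap a b = 1 \<longleftrightarrow> \<bar>int a - int b\<bar> = 1" "a = b \<longleftrightarrow> \<bar>int a - int b\<bar> = 0"
      by (auto simp: gap_def)
    moreover have "2 \<le> \<bar>2 * int x - 2 * int y\<bar>" if "x \<noteq> y"
      using that by auto
    ultimately show ?thesis
      by (cases "x = y") (auto simp: st)
  next
    fix x a y z i assume st: "s = Gad x a" "t = Half y z i"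
    then show ?thesis
      using assms l1_dist_Gad_Half[of y z i x a] by simp
  next
    fix x a y z i assume st: "s = Half y z i" "t = Gad x a"
    have sym: "R s t \<longleftrightarrow> R t s" "l1_dist (grid K s) (grid K t) = l1_dist (grid K t) (grid K s)"
      using symp_R l1_dist_sym by (auto dest: sympD)
    have "(R t s \<longrightarrow> l1_dist (grid K t) (grid K s) = 1) \<and>
        (\<not> R t s \<longrightarrow> t \<noteq> s \<longrightarrow> 2 \<le> l1_dist (grid K t) (grid K s))"
      using assms l1_dist_Gad_Half[of y z i x a] by (simp add: st)
    then show ?thesis
      unfolding sym by blast
  next
    fix x y i x' y' j assume st: "s = Half x y i" "t = Half x' y' j"
    then show ?thesis
      using assms l1_dist_Half_Half[of x y i x' y' j] by simp
  qed
  then show "R s t \<Longrightarrow> l1_dist (grid K s) (grid K t) = 1"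
    "\<not> R s t \<Longrightarrow> s \<noteq> t \<Longrightarrow> 2 \<le> l1_dist (grid K s) (grid K t)"
    by blast+
qed

end

lemma grid_embedding_exists: "\<exists>V E M K. grid_embedding V E k M K"
proof -
  obtain V E where "base_graph V E k"
    using base_graph_exists by blast
  then interpret base_graph V E k .
  obtain c where c: "\<And>x y. x \<in> V \<Longrightarrow> y \<in> V \<Longrightarrow> code x y < c"
    using code_bounded[OF finite_V] by blast
  obtain b where b: "\<And>x. x \<in> V \<Longrightarrow> x < b"
    using finite_V unfolding finite_nat_set_iff_bounded by blast
  have "grid_embedding V E k (3 * c) (3 * c + b + 2)"
  proof unfold_locales
    show "plane x y \<le> 3 * c" if "x \<in> V" "y \<in> V" for x y
      using c[OF that] by (simp add: plane_def)
    show "gap x y + 2 \<le> 3 * c + b + 2" if "x \<in> V" "y \<in> V" for x y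
      using b[OF that(1)] b[OF that(2)] by (simp add: gap_def)
  qed simp
  then show ?thesis
    by blast
qed

section \<open>Unit balls and unit cubes in contact like grid points\<close>

lemma max_cn_intersection_class_grid:
  fixes g :: "int \<times> int \<times> int \<Rightarrow> 'b set"
  assumes "range g \<subseteq> S" and meet: "\<And>u v. g u \<inter> g v \<noteq> {} \<longleftrightarrow> l1_dist u v \<le> 1"
  shows "max_cn (intersection_class S) = \<infinity>"
proof (rule max_cn_eq_infinity)
  fix k
  obtain V E M K where "grid_embedding V E k M K"
    using grid_embedding_exists by blast
  then interpret grid_embedding V E k M K .
  have "inj g"
  proof (rule injI)
    fix u v :: "int \<times> int \<times> int" assume eq: "g u = g v"
    obtain a b c where u: "u = (a, b, c)" by (cases u)
    obtain a' b' c' where v: "v = (a', b', c')" by (cases v)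
    \<comment> \<open>The reflection of \<open>v\<close> in \<open>u\<close>: if \<open>u\<close>
      and \<open>v\<close> were at distance 1, then \<open>w\<close> would be at distance 1 from
      \<open>u\<close> but 2 from \<open>v\<close>.\<close>
    define w where "w = (2 * a - a', 2 * b - b', 2 * c - c')"
    have same: "l1_dist u z \<le> 1 \<longleftrightarrow> l1_dist v z \<le> 1" for z
      using meet[of u z] meet[of v z] eq by (simp only:)
    have double: "\<bar>2 * p - 2 * q\<bar> = 2 * \<bar>p - q\<bar>" for p q :: int
      by (cases "p \<le> q") simp_all
    have w: "l1_dist u w = l1_dist v u" "l1_dist v w = 2 * l1_dist v u"
      by (simp_all add: u v w_def double)
    have "l1_dist u u \<le> 1"
      by (simp add: u)
    then have "l1_dist v u \<le> 1"
      using same[of u] by blast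
    then have "l1_dist v w \<le> 1"
      using same[of w] unfolding w(1) by blast
    then have "l1_dist v u \<le> 0"
      unfolding w(2) by linarith
    then have "a' = a \<and> b' = b \<and> c' = c"
      unfolding u v l1_dist.simps by linarith
    then show "u = v"
      by (simp add: u v)
  qed
  have "H \<in> intersection_class S"
  proof (rule intersection_class_coded_graph[OF finite_N symp_R irreflp_R])
    show "(g \<circ> grid K) ` N \<subseteq> S"
      using assms(1) by auto
    show "R s t \<longleftrightarrow> (g \<circ> grid K) s \<inter> (g \<circ> grid K) t \<noteq> {}" if "s \<in> N" "t \<in> N" "s \<noteq> t" for s t
      using l1_dist_grid[OF that(1,2)] that(3) unfolding comp_apply meet by fastforce
    have "grid K s \<noteq> grid K t" if "s \<in> N" "t \<in> N" "s \<noteq> t" for s t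
    proof
      assume "grid K s = grid K t"
      moreover have "l1_dist z z = 0" for z
        by (cases z) simp
      ultimately have "l1_dist (grid K s) (grid K t) = 0"
        by (simp only:)
      with l1_dist_grid[OF that(1,2)] that(3) show False
        by fastforce
    qed
    then show "inj_on (g \<circ> grid K) N"
      by (intro inj_onI) (metis \<open>inj g\<close> comp_apply injD)
  qed
  with connected_H cop_number_H show "\<exists>G\<in>intersection_class S. connected_graph G \<and> k < cop_number G"
    by blast
qed

lemma cball_Int_cball_nonempty_iff:
  fixes a b :: "'a::real_normed_vector"
  assumes "0 \<le> r"
  shows "cball a r \<inter> cball b r \<noteq> {} \<longleftrightarrow> dist a b \<le> 2 * r"
proof
  assume "cball a r \<inter> cball b r \<noteq> {}"
  then obtain x where "dist a x \<le> r" "dist b x \<le> r"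
    by auto
  then show "dist a b \<le> 2 * r"
    using dist_triangle2[of a b x] by simp
next
  assume "dist a b \<le> 2 * r"
  then have "midpoint a b \<in> cball a r \<inter> cball b r"
    by (simp add: dist_midpoint)
  then show "cball a r \<inter> cball b r \<noteq> {}"
    by blast
qed

text \<open>Links Euclidean and \<open>l1_dist\<close> contact: an integer is bounded in absolute
  value by its square, with equality for -1, 0 and 1.\<close>

lemma sum_squares_le_1_iff:
  fixes a b c :: int
  shows "a\<^sup>2 + b\<^sup>2 + c\<^sup>2 \<le> 1 \<longleftrightarrow> \<bar>a\<bar> + \<bar>b\<bar> + \<bar>c\<bar> \<le> 1"
proof
  have le: "\<bar>x\<bar> \<le> x\<^sup>2" for x :: int
  proof (cases "x = 0")
    case False
    then have "\<bar>x\<bar> * 1 \<le> \<bar>x\<bar> * \<bar>x\<bar>"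
      by (intro mult_left_mono) auto
    then show ?thesis
      by (simp add: power2_eq_square)
  qed simp
  show "\<bar>a\<bar> + \<bar>b\<bar> + \<bar>c\<bar> \<le> 1" if "a\<^sup>2 + b\<^sup>2 + c\<^sup>2 \<le> 1"
    using that le[of a] le[of b] le[of c] by linarith
next
  have le: "x\<^sup>2 \<le> \<bar>x\<bar>" if "\<bar>x\<bar> \<le> 1" for x :: int
  proof -
    have "x = -1 \<or> x = 0 \<or> x = 1"
      using that by linarith
    then show ?thesis
      by auto
  qed
  show "a\<^sup>2 + b\<^sup>2 + c\<^sup>2 \<le> 1" if "\<bar>a\<bar> + \<bar>b\<bar> + \<bar>c\<bar> \<le> 1"
    using that le[of a] le[of b] le[of c] by linarith
qed

lemma max_cn_unit_balls3: "max_cn (intersection_class unit_balls3) = \<infinity>"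
proof (rule max_cn_intersection_class_grid)
  \<comment> \<open>The scale 2 makes unit balls at neighbouring grid points just touch.\<close>
  let ?c = "\<lambda>(a, b, c). vector [2 * real_of_int a, 2 * real_of_int b, 2 * real_of_int c] :: real^3"
  show "range (\<lambda>u. cball (?c u) 1) \<subseteq> unit_balls3"
    unfolding unit_balls3_def by blast
  show "cball (?c u) 1 \<inter> cball (?c v) 1 \<noteq> {} \<longleftrightarrow> l1_dist u v \<le> 1" for u v
  proof -
    obtain a b c where u: "u = (a, b, c)" by (cases u)
    obtain a' b' c' where v: "v = (a', b', c')" by (cases v)
    define q where "q = (a - a')\<^sup>2 + (b - b')\<^sup>2 + (c - c')\<^sup>2"
    have "(dist (?c u) (?c v))\<^sup>2 = 4 * of_int q"
      unfolding dist_norm power2_norm_eq_inner q_def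
      by (simp add: u v inner_vec_def sum_3 power2_eq_square algebra_simps)
    moreover have "dist (?c u) (?c v) \<le> 2 \<longleftrightarrow> (dist (?c u) (?c v))\<^sup>2 \<le> 2\<^sup>2"
      by (rule power_mono_iff[symmetric]) auto
    ultimately have "dist (?c u) (?c v) \<le> 2 \<longleftrightarrow> q \<le> 1"
      by simp
    then show ?thesis
      using cball_Int_cball_nonempty_iff[of 1 "?c u" "?c v"] by (simp add: u v q_def sum_squares_le_1_iff)
  qed
qed

text \<open>Unit cubes at the points of the integer grid would also touch diagonally; this sheared lattice
  keeps only the contacts between grid neighbours.\<close>
lemma cube_lattice:
  fixes a b c :: int
  shows "\<bar>10 * a - 4 * b + 5 * c\<bar> \<le> 10 \<and> \<bar>5 * a + 10 * b - 4 * c\<bar> \<le> 10 \<and> \<bar>5 * b + 10 * c - 4 * a\<bar> \<le> 10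
    \<longleftrightarrow> \<bar>a\<bar> + \<bar>b\<bar> + \<bar>c\<bar> \<le> 1" (is "?L \<longleftrightarrow> ?R")
proof -
  \<comment> \<open>Either side confines each coordinate to -1, 0 or 1, so 27 cases remain.\<close>
  have cases: "?L \<longleftrightarrow> ?R" if "a \<in> {-1, 0, 1}" "b \<in> {-1, 0, 1}" "c \<in> {-1, 0, 1}"
    using that by auto
  have small: "x \<in> {-1, 0, 1}" if "-1 \<le> x" "x \<le> 1" for x :: int
    using that by auto
  show ?thesis
  proof
    assume ?L
    have "-10 \<le> 10 * a - 4 * b + 5 * c" "10 * a - 4 * b + 5 * c \<le> 10"
      "-10 \<le> 5 * a + 10 * b - 4 * c" "5 * a + 10 * b - 4 * c \<le> 10"
      "-10 \<le> 5 * b + 10 * c - 4 * a" "5 * b + 10 * c - 4 * a \<le> 10"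
      using \<open>?L\<close> unfolding abs_le_iff by linarith+
    then have "a \<in> {-1, 0, 1}" "b \<in> {-1, 0, 1}" "c \<in> {-1, 0, 1}"
      by (intro small; linarith)+
    with cases \<open>?L\<close> show ?R
      by blast
  next
    assume ?R
    then have "a \<in> {-1, 0, 1}" "b \<in> {-1, 0, 1}" "c \<in> {-1, 0, 1}"
      by (intro small; linarith)+
    with cases \<open>?R\<close> show ?L
      by blast
  qed
qed

lemma max_cn_unit_cubes3: "max_cn (intersection_class unit_cubes3) = \<infinity>"
proof (rule max_cn_intersection_class_grid)
  \<comment> \<open>Positions are multiples of 1/10, so unit intervals meet exactly when the
    numerators differ by at most 10.\<close>
  let ?x = "\<lambda>(a, b, c). real_of_int (10 * a - 4 * b + 5 * c) / 10"
  let ?y = "\<lambda>(a, b, c). real_of_int (5 * a + 10 * b - 4 * c) / 10"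
  let ?z = "\<lambda>(a, b, c). real_of_int (5 * b + 10 * c - 4 * a) / 10"
  let ?g = "\<lambda>u. box3 (?x u) (?x u + 1) (?y u) (?y u + 1) (?z u) (?z u + 1)"
  show "range ?g \<subseteq> unit_cubes3"
  proof
    fix s assume "s \<in> range ?g"
    then obtain u where "s = ?g u" by blast
    then show "s \<in> unit_cubes3"
      unfolding unit_cubes3_def box3_def
      by (intro CollectI exI[of _ "vector [?x u, ?y u, ?z u]"] exI[of _ "vector [?x u + 1, ?y u + 1, ?z u + 1]"])
        (simp add: forall_3)
  qed
  show "?g u \<inter> ?g v \<noteq> {} \<longleftrightarrow> l1_dist u v \<le> 1" for u v
  proof -
    obtain a b c where u: "u = (a, b, c)" by (cases u)
    obtain a' b' c' where v: "v = (a', b', c')" by (cases v)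
    have meet: "max (real_of_int m / 10) (real_of_int n / 10) \<le> min (real_of_int m / 10 + 1) (real_of_int n / 10 + 1)
      \<longleftrightarrow> \<bar>m - n\<bar> \<le> 10" for m n
      by linarith
    have "?g u \<inter> ?g v \<noteq> {} \<longleftrightarrow> \<bar>10 * (a - a') - 4 * (b - b') + 5 * (c - c')\<bar> \<le> 10 \<and>
        \<bar>5 * (a - a') + 10 * (b - b') - 4 * (c - c')\<bar> \<le> 10 \<and> \<bar>5 * (b - b') + 10 * (c - c') - 4 * (a - a')\<bar> \<le> 10"
      unfolding u v box3_meet_iff prod.case meet by (simp only: algebra_simps)
    also have "\<dots> \<longleftrightarrow> l1_dist u v \<le> 1"
      unfolding u v l1_dist.simps by (rule cube_lattice)
    finally show ?thesis .
  qed
qed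

section \<open>Transfer to the larger classes by monotonicity\<close>

theorem theorem2:
  shows "max_cn line_graphs = \<infinity>
    \<and> max_cn (intersection_class two_intervals) = \<infinity>
    \<and> max_cn (intersection_class two_unit_intervals) = \<infinity>
    \<and> max_cn (intersection_class axis_segments3) = \<infinity>
    \<and> max_cn (intersection_class axis_boxes3) = \<infinity>
    \<and> max_cn (intersection_class unit_cubes3) = \<infinity>
    \<and> max_cn (intersection_class balls3) = \<infinity>
    \<and> max_cn (intersection_class unit_balls3) = \<infinity>"
proof -
  have mono: "max_cn \<D> = \<infinity>" if "\<C> \<subseteq> \<D>" "max_cn \<C> = \<infinity>" for \<C> \<D>
    using max_cn_mono[OF that(1)] that(2) by (simp add: top_unique flip: top_enat_def)
  have class_mono: "max_cn (intersection_class T) = \<infinity>"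
    if "S \<subseteq> T" "max_cn (intersection_class S) = \<infinity>" for S T :: "'b set set"
    using mono[OF intersection_class_mono[OF that(1)] that(2)] .
  have two_unit: "max_cn (intersection_class two_unit_intervals) = \<infinity>"
    using mono[OF line_graphs_subset_two_unit_intervals max_cn_line_graphs] .
  show ?thesis
    using max_cn_line_graphs two_unit class_mono[OF two_unit_intervals_subset two_unit]
      max_cn_axis_segments3 class_mono[OF axis_segments3_subset max_cn_axis_segments3]
      max_cn_unit_cubes3 max_cn_unit_balls3 class_mono[OF unit_balls3_subset max_cn_unit_balls3]
    by blast
qed

end
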